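(* Let $\mathcal{H}$ be a real Hilbert space, $J\in\mathcal{C}$, and let the gradient flow of $J$ with initial datum $f$ generate eigenvectors, i.e. $p(t)\in\partial J(p(t))$ for all $t>0$. Let $\{v(t):t>0\}$ be the solutions of the variational problems $$v(t)=\arg\min_{v\in\mathcal{H}}\ \frac12\|v-f\|^2+tJ(v)$$ with associated subgradients $q(t):=\frac{f-v(t)}{t}\in\partial J(v(t))$. Then, with $\tau:=1/t$, the pair $(w,r)$ given by $$w(\tau):=v(1/\tau)-\frac1\tau v'(1/\tau),\qquad r(\tau):=q(1/\tau)$$ is a solution of the inverse scale space flow $$\partial_\tau r(\tau)=f-w(\tau),\qquad r(\tau)\in\partial J(w(\tau)),\qquad r(0)=0,\ w(0)=\bar f.$$
   Context: The class $\mathcal{C}$ consists of all maps $J:\mathcal{H}\to\mathbb{R}\cup\{+\infty\}$ that are convex, lower semicontinuous with respect to the strong topology of $\mathcal{H}$, and absolutely one-homogeneous, i.e. $J(cu)=|c|J(u)$ for all $u\in\mathcal{H}$, $c\in\mathbb{R}\setminus\{0\}$, and $J(0)=0$. The subdifferential is $\partial J(u)=\{p\in\mathcal{H}:\langle p,v\rangle\le J(v)\ \forall v\in\mathcal{H},\ \langle p,u\rangle=J(u)\}$, and $\mathrm{dom}(\partial J)=\{u:\partial J(u)\ne\emptyset\}$. $\bar f$ is the orthogonal projection of $f$ onto the closed linear space $\mathcal{N}(J)=\{u:J(u)=0\}$. Gradient flow: for $f\in\overline{\mathrm{dom}(\partial J)}$, the solution $(u,p)$ of $\partial_tu(t)=-p(t)$,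 $p(t)\in\partial J(u(t))$, $u(0)=f$ is the unique continuous $u:[0,\infty)\to\mathcal{H}$ with $u(0)=f$ given by Brezis' theory (Lipschitz on $[\delta,\infty)$ for every $\delta>0$, $u(t)\in\mathrm{dom}(\partial J)$ for all $t>0$, right-differentiable at every $t>0$), together with $p(t):=-\partial_t^+u(t)$, which is the element of minimal norm in $\partial J(u(t))$ for every $t>0$. Conventions: $v'(1/\tau)$ denotes the right-derivative $\partial_t^+v(t)$ evaluated at $t=1/\tau$ (it exists because under the hypothesis $v(t)=u(t)$ for $t>0$). The derivative $\partial_\tau r$ is understood in the weak sense, existing for almost every $\tau>0$; the inclusion $r(\tau)\in\partial J(w(\tau))$ is for $\tau>0$; the initial conditions are understood as the limits as $\tau\searrow0$. *)

theory Defs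
  imports "HOL-Analysis.Analysis"
begin

text \<open>Throughout, a real Hilbert space is a type of sort \<open>{real_inner, complete_space}\<close>; no
  separability is assumed. Maps into \<open>\<real> \<union> {+\<infinity>}\<close> are \<open>ereal\<close>-valued maps that avoid \<open>-\<infinity>\<close>.\<close>

definition class_C :: "('a::{real_inner,complete_space} \<Rightarrow> ereal) \<Rightarrow> bool" where
  "class_C J \<longleftrightarrow>
     (\<forall>u. J u \<noteq> -\<infinity>) \<and>
     (\<forall>u v. \<forall>s. 0 < s \<and> s < 1 \<longrightarrow>
        J ((1 - s) *\<^sub>R u + s *\<^sub>R v) \<le> ereal (1 - s) * J u + ereal s * J v) \<and>
     (\<forall>u. J u \<le> Liminf (at u) J) \<and>
     (\<forall>u. \<forall>c. c \<noteq> 0 \<longrightarrow> J (c *\<^sub>R u) = ereal \<bar>c\<bar> * J u) \<and>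
     J 0 = 0"

definition subdiff :: "('a::{real_inner,complete_space} \<Rightarrow> ereal) \<Rightarrow> 'a \<Rightarrow> 'a set" where
  "subdiff J u = {p. (\<forall>v. ereal (p \<bullet> v) \<le> J v) \<and> ereal (p \<bullet> u) = J u}"

definition dom_subdiff :: "('a::{real_inner,complete_space} \<Rightarrow> ereal) \<Rightarrow> 'a set" where
  "dom_subdiff J = {u. subdiff J u \<noteq> {}}"

definition nullspace :: "('a::{real_inner,complete_space} \<Rightarrow> ereal) \<Rightarrow> 'a set" where
  "nullspace J = {u. J u = 0}"

text \<open>Meaningful when \<open>S\<close> is a closed linear subspace, as \<open>nullspace J\<close> is for \<open>J\<close> in the class.\<close>

definition orth_proj :: "'a::{real_inner,complete_space} set \<Rightarrow> 'a \<Rightarrow> 'a" where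
  "orth_proj S x = (THE y. y \<in> S \<and> (\<forall>z\<in>S. orthogonal (x - y) z))"

text \<open>The solution of the gradient flow in the sense of Brezis. The second component is minus the
  right derivative of the first, and the element of minimal norm of the subdifferential.\<close>

definition gradient_flow ::
    "('a::{real_inner,complete_space} \<Rightarrow> ereal) \<Rightarrow> 'a \<Rightarrow> (real \<Rightarrow> 'a) \<Rightarrow> (real \<Rightarrow> 'a) \<Rightarrow> bool" where
  "gradient_flow J f u p \<longleftrightarrow>
     continuous_on {0..} u \<and> u 0 = f \<and>
     (\<forall>\<delta>>0. \<exists>L. L-lipschitz_on {\<delta>..} u) \<and>
     (\<forall>t>0. u t \<in> dom_subdiff J) \<and>
     (\<forall>t>0. (u has_vector_derivative - p t) (at_right t)) \<and>
     (\<forall>t>0. is_arg_min norm (\<lambda>x. x \<in> subdiff J (u t)) (p t))"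

definition variational_energy ::
    "('a::{real_inner,complete_space} \<Rightarrow> ereal) \<Rightarrow> 'a \<Rightarrow> real \<Rightarrow> 'a \<Rightarrow> ereal" where
  "variational_energy J f t x = ereal ((norm (x - f))\<^sup>2 / 2) + ereal t * J x"

definition test_function_pos :: "(real \<Rightarrow> real) \<Rightarrow> bool" where
  "test_function_pos \<phi> \<longleftrightarrow>
     (\<forall>k x. (deriv ^^ k) \<phi> differentiable (at x)) \<and>
     (\<exists>a b. 0 < a \<and> a \<le> b \<and> (\<forall>x. x \<notin> {a..b} \<longrightarrow> \<phi> x = 0))"

text \<open>Local Bochner integrability on \<open>(0,\<infinity>)\<close>: strong measurability (which is what
  \<open>measurable_on\<close> expresses, an almost everywhere limit of continuous functions) together with an
  integrable norm. The library's Bochner integral requires a second countable target, so the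
  Henstock--Kurzweil integral is used; it agrees with the Bochner integral on
  Bochner integrable functions.\<close>

definition locally_bochner_integrable_pos :: "(real \<Rightarrow> 'a::real_normed_vector) \<Rightarrow> bool" where
  "locally_bochner_integrable_pos g \<longleftrightarrow>
     (\<forall>a b. 0 < a \<and> a \<le> b \<longrightarrow>
        g measurable_on {a..b} \<and> (\<lambda>x. norm (g x)) integrable_on {a..b})"

definition has_weak_derivative_pos ::
    "(real \<Rightarrow> 'a::real_normed_vector) \<Rightarrow> (real \<Rightarrow> 'a) \<Rightarrow> bool" where
  "has_weak_derivative_pos r g \<longleftrightarrow>
     locally_bochner_integrable_pos r \<and> locally_bochner_integrable_pos g \<and>
     (\<forall>\<phi>. test_function_pos \<phi> \<longrightarrow>
        (\<exists>I. ((\<lambda>x. deriv \<phi> x *\<^sub>R r x) has_integral I) {0<..} \<and>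
             ((\<lambda>x. \<phi> x *\<^sub>R g x) has_integral - I) {0<..}))"

text \<open>The equation holds weakly and, for the given representative of \<open>r\<close>, also classically at almost
  every time; the initial conditions are one-sided limits at \<open>0\<close>.\<close>

definition inverse_scale_space_flow ::
    "('a::{real_inner,complete_space} \<Rightarrow> ereal) \<Rightarrow> 'a \<Rightarrow> (real \<Rightarrow> 'a) \<Rightarrow> (real \<Rightarrow> 'a) \<Rightarrow> bool" where
  "inverse_scale_space_flow J f w r \<longleftrightarrow>
     has_weak_derivative_pos r (\<lambda>\<tau>. f - w \<tau>) \<and>
     (AE \<tau> in lborel. \<tau> > 0 \<longrightarrow> (r has_vector_derivative f - w \<tau>) (at \<tau>)) \<and>
     (\<forall>\<tau>>0. r \<tau> \<in> subdiff J (w \<tau>)) \<and>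
     (r \<longlongrightarrow> 0) (at_right 0) \<and>
     (w \<longlongrightarrow> orth_proj (nullspace J) f) (at_right 0)"

end

theory Submission
  imports Defs
begin

text \<open>
  Everything rests on one property of a flow that generates eigenvectors: a subgradient \<open>p s\<close> stays
  a subgradient at all later times, \<open>p s \<in> subdiff J (u t)\<close> for \<open>0 < s \<le> t\<close>
  (\<open>p_in_later_subdiff\<close>). Indeed the gap \<open>J (u t) - p s \<bullet> u t\<close> is nonnegative, vanishes at
  \<open>t = s\<close>, and has right derivative \<open>p s \<bullet> p t - (norm (p t))\<^sup>2\<close>. Since \<open>p s\<close> is a subgradient of
  \<open>J\<close> at \<open>0\<close> and \<open>J (p t) = (norm (p t))\<^sup>2\<close> for an eigenvector, this derivative is at most \<open>0\<close>.

  As \<open>subdiff J (u t)\<close> is closed and convex, it then contains the mean values of \<open>p\<close> over \<open>(s, t)\<close>,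
  which are \<open>(u s - u t) / (t - s)\<close>, and in the limit also \<open>q t = (f - u t) / t\<close>. This has the
  following consequences.

  \<^item> \<open>u t\<close> satisfies the optimality condition of the variational problem, so \<open>v = u\<close> and
    \<open>v' = - p\<close>; hence \<open>w \<tau> = u t + t p t\<close> and \<open>r \<tau> = \<tau> (f - u t)\<close> with \<open>t = 1 / \<tau>\<close>.
  \<^item> \<open>q t \<bullet> p t = (norm (p t))\<^sup>2 = J (p t)\<close>: minimality of \<open>p t\<close> in \<open>subdiff J (u t)\<close> gives one
    inequality, the eigenvector property the other. By subadditivity of \<open>J\<close>, therefore, \<open>q t\<close> is
    a subgradient at \<open>u t + t p t\<close>.
  \<^item> The mean value over \<open>(s, t)\<close> has squared distance at most \<open>(norm (p s))\<^sup>2 - (norm (p t))\<^sup>2\<close> from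
    \<open>p t\<close>. So \<open>u\<close> is differentiable wherever the monotone function \<open>norm (p t)\<close> is continuous,
    that is, outside a countable set, and there the chain rule gives \<open>r' = f - w\<close>. A continuous
    function with locally bounded derivative outside a countable set has it as weak derivative.
  \<^item> \<open>(norm (u s - u t))\<^sup>2 \<le> (norm (u s))\<^sup>2 - (norm (u t))\<^sup>2\<close>, so \<open>u\<close> converges as \<open>t \<rightarrow> \<infinity>\<close>. Its limit
    is a zero of \<open>J\<close>, and \<open>f - u t\<close> is orthogonal to all zeros of \<open>J\<close>. Comparing \<open>p t\<close> with the mean
    value over \<open>(t / 2, t)\<close> gives \<open>t p t \<rightarrow> 0\<close>. These are the initial conditions.

  The derivative of \<open>J (u t)\<close> used above requires \<open>p\<close> to be right continuous. This holds because
  \<open>norm (p t)\<close> is nonincreasing and the \<open>\<epsilon>\<close>-subdifferentials at \<open>u t\<close> shrink to \<open>subdiff J (u t)\<close>,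
  so that their elements of nearly minimal norm converge to \<open>p t\<close>.
\<close>

section \<open>Elements of minimal norm in Hilbert spaces\<close>

text \<open>This replaces weak compactness. By the parallelogram law, points that nearly minimize the norm over
  the sets form a Cauchy sequence; the norm of its limit is the supremum of the minimal norms.
  A constant sequence gives the element of minimal norm of a single set.\<close>

lemma nested_convex_min_norm:
  fixes S :: "nat \<Rightarrow> 'a::{real_inner,complete_space} set"
  assumes closed: "\<And>n. closed (S n)" and convex: "\<And>n. convex (S n)" and "decseq S"
    and bounded: "\<And>n. \<exists>x\<in>S n. norm x \<le> M"
  shows "\<exists>z. (\<forall>n. z \<in> S n) \<and> (\<forall>c<norm z. \<exists>n. \<forall>x\<in>S n. c < norm x)"
proof -
  define d where "d n = (INF x\<in>S n. norm x)" for n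
  have ne: "S n \<noteq> {}" for n
    using bounded[of n] by auto
  have bdd: "bdd_below (norm ` S n)" for n
    by (rule bdd_belowI2[where m = 0]) simp
  have sub: "S m \<subseteq> S n" if "n \<le> m" for m n
    using \<open>decseq S\<close> that by (auto simp: decseq_def)
  have d_le: "d n \<le> norm x" if "x \<in> S n" for n x
    unfolding d_def using that by (intro cINF_lower bdd)
  have d_nonneg: "0 \<le> d n" for n
    unfolding d_def using ne by (intro cINF_greatest) auto
  have "incseq d"
    unfolding incseq_def d_def using sub ne bdd by (auto intro!: cINF_superset_mono)
  moreover have "d n \<le> M" for n
    using bounded[of n] d_le by force
  ultimately obtain D where D: "d \<longlonglongrightarrow> D" and d_le_D: "\<And>n. d n \<le> D"
    using incseq_convergent[of d M] by blast
  have "\<exists>x\<in>S n. norm x < D + 1 / real (Suc n)" for n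
  proof -
    have "d n < D + 1 / real (Suc n)"
      using d_le_D[of n] by (smt (verit) divide_pos_pos of_nat_0_less_iff zero_less_Suc)
    then show ?thesis
      unfolding d_def using cINF_less_iff[OF ne bdd] by blast
  qed
  then obtain x where x: "\<And>n. x n \<in> S n" "\<And>n. norm (x n) < D + 1 / real (Suc n)"
    by metis
  have inv0: "(\<lambda>n. 1 / real (Suc n)) \<longlonglongrightarrow> 0"
    using LIMSEQ_inverse_real_of_nat by (simp add: inverse_eq_divide)
  have "(\<lambda>n. 4 * ((D + 1 / real (Suc n))\<^sup>2 - (d n)\<^sup>2)) \<longlonglongrightarrow> 4 * ((D + 0)\<^sup>2 - D\<^sup>2)"
    by (intro tendsto_intros D inv0)
  then have gap: "(\<lambda>n. 4 * ((D + 1 / real (Suc n))\<^sup>2 - (d n)\<^sup>2)) \<longlonglongrightarrow> 0"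
    by simp
  have dist_x: "(dist (x n) (x m))\<^sup>2 \<le> 4 * ((D + 1 / real (Suc n))\<^sup>2 - (d n)\<^sup>2)" if "n \<le> m" for m n
  proof -
    have "(1/2) *\<^sub>R x n + (1/2) *\<^sub>R x m \<in> S n"
      using x(1) sub[OF that] by (intro convexD[OF convex]) auto
    then have "(d n)\<^sup>2 \<le> (norm ((1/2) *\<^sub>R x n + (1/2) *\<^sub>R x m))\<^sup>2"
      using d_le d_nonneg by (intro power_mono) auto
    moreover have "(dist (x n) (x m))\<^sup>2 = 2 * (norm (x n))\<^sup>2 + 2 * (norm (x m))\<^sup>2
        - 4 * (norm ((1/2) *\<^sub>R x n + (1/2) *\<^sub>R x m))\<^sup>2"
      by (simp add: dist_norm power2_norm_eq_inner inner_simps inner_commute)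
    moreover have "norm (x m) \<le> D + 1 / real (Suc n)"
    proof -
      have "1 / real (Suc m) \<le> 1 / real (Suc n)"
        using that by (intro divide_left_mono) auto
      then show ?thesis using x(2)[of m] by linarith
    qed
    then have "(norm (x m))\<^sup>2 \<le> (D + 1 / real (Suc n))\<^sup>2"
      by (intro power_mono) auto
    moreover have "(norm (x n))\<^sup>2 \<le> (D + 1 / real (Suc n))\<^sup>2"
      using x(2)[of n] by (intro power_mono) auto
    ultimately show ?thesis by argo
  qed
  have "Cauchy x"
  proof (rule metric_CauchyI)
    fix e :: real assume "e > 0"
    then have "\<forall>\<^sub>F n in sequentially. 4 * ((D + 1 / real (Suc n))\<^sup>2 - (d n)\<^sup>2) < e\<^sup>2"
      by (intro order_tendstoD(2)[OF gap]) auto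
    then obtain N where N: "\<And>n. n \<ge> N \<Longrightarrow> 4 * ((D + 1 / real (Suc n))\<^sup>2 - (d n)\<^sup>2) < e\<^sup>2"
      by (auto simp: eventually_sequentially)
    have *: "dist (x n) (x m) < e" if "N \<le> n" "n \<le> m" for n m
      using le_less_trans[OF dist_x[OF that(2)] N[OF that(1)]] \<open>e > 0\<close>
      by (simp add: power2_less_imp_less)
    have "dist (x m) (x n) < e" if "m \<ge> N" "n \<ge> N" for m n
      using *[of m n] *[of n m] that by (metis dist_commute le_cases)
    then show "\<exists>N. \<forall>m\<ge>N. \<forall>n\<ge>N. dist (x m) (x n) < e" by blast
  qed
  then obtain z where z: "x \<longlonglongrightarrow> z"
    using Cauchy_convergent_iff convergent_def by blast
  show ?thesis
  proof (intro exI[of _ z] conjI allI impI)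
    show "z \<in> S n" for n
    proof (rule Lim_in_closed_set[OF closed _ _ z])
      show "\<forall>\<^sub>F m in sequentially. x m \<in> S n"
        unfolding eventually_sequentially using x(1) sub by blast
    qed simp
    have "(\<lambda>n. norm (x n)) \<longlonglongrightarrow> D"
    proof (rule tendsto_sandwich[OF _ _ D])
      show "(\<lambda>n. D + 1 / real (Suc n)) \<longlonglongrightarrow> D"
        using tendsto_add[OF tendsto_const inv0, of D] by simp
    qed (use x d_le in \<open>auto intro!: always_eventually less_imp_le\<close>)
    then have "norm z = D"
      using tendsto_norm[OF z] LIMSEQ_unique by blast
    fix c assume "c < norm z"
    then have "\<forall>\<^sub>F n in sequentially. c < d n"
      using order_tendstoD(1)[OF D] \<open>norm z = D\<close> by blast
    then obtain n where "c < d n"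
      by (auto simp: eventually_sequentially)
    then show "\<exists>n. \<forall>x\<in>S n. c < norm x"
      using d_le by (meson less_le_trans)
  qed
qed

text \<open>By the previous lemma the minimal norms over the sets tend to the minimal norm over the
  intersection. The midpoint of \<open>x\<close> and \<open>y\<close> therefore cannot be much shorter than \<open>y\<close>, and the
  parallelogram law bounds \<open>norm (x - y)\<close>.\<close>

lemma nested_convex_near_min_norm:
  fixes S :: "nat \<Rightarrow> 'a::{real_inner,complete_space} set"
  assumes closed: "\<And>n. closed (S n)" and convex: "\<And>n. convex (S n)" and "decseq S"
    and y: "\<And>n. y \<in> S n" and min: "\<And>z. (\<And>n. z \<in> S n) \<Longrightarrow> norm y \<le> norm z"
    and "e > 0"
  obtains n where "\<And>x. x \<in> S n \<Longrightarrow> norm x \<le> norm y \<Longrightarrow> norm (x - y) < e"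
proof (cases "y = 0")
  case True
  then show thesis using that \<open>e > 0\<close> by auto
next
  case False
  obtain z where z: "\<And>n. z \<in> S n" "\<And>c. c < norm z \<Longrightarrow> \<exists>n. \<forall>x\<in>S n. c < norm x"
    using nested_convex_min_norm[OF closed convex \<open>decseq S\<close>, of "norm y"] y by (metis order_refl)
  define c where "c = sqrt (max 0 ((norm y)\<^sup>2 - e\<^sup>2 / 4))"
  have "c < sqrt ((norm y)\<^sup>2)"
    unfolding c_def using False \<open>e > 0\<close> by (intro real_sqrt_less_mono) auto
  then have "c < norm z"
    using min[OF z(1)] by simp
  then obtain n where n: "\<And>x. x \<in> S n \<Longrightarrow> c < norm x"
    using z(2) by blast
  have "norm (x - y) < e" if x: "x \<in> S n" "norm x \<le> norm y" for x
  proof -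
    have "(1/2) *\<^sub>R x + (1/2) *\<^sub>R y \<in> S n"
      using x(1) y by (intro convexD[OF convex]) auto
    then have "c\<^sup>2 < (norm ((1/2) *\<^sub>R x + (1/2) *\<^sub>R y))\<^sup>2"
      using n by (intro power_strict_mono) (auto simp: c_def)
    moreover have "(norm y)\<^sup>2 - e\<^sup>2 / 4 \<le> c\<^sup>2"
      unfolding c_def by simp
    moreover have "(norm (x - y))\<^sup>2 = 2 * (norm x)\<^sup>2 + 2 * (norm y)\<^sup>2
        - 4 * (norm ((1/2) *\<^sub>R x + (1/2) *\<^sub>R y))\<^sup>2"
      by (simp add: power2_norm_eq_inner inner_simps inner_commute)
    moreover have "(norm x)\<^sup>2 \<le> (norm y)\<^sup>2"
      using x(2) by (intro power_mono) auto
    ultimately have "(norm (x - y))\<^sup>2 < e\<^sup>2" by argo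
    then show ?thesis using \<open>e > 0\<close> by (simp add: power2_less_imp_less)
  qed
  then show thesis using that by blast
qed

lemma decseq_const: "decseq (\<lambda>_. c)"
  by (simp add: decseq_def)

lemma min_norm_inner_ge:
  fixes x y :: "'a::real_inner"
  assumes "convex S" "closed S" "x \<in> S" "y \<in> S" "\<And>z. z \<in> S \<Longrightarrow> norm x \<le> norm z"
  shows "(norm x)\<^sup>2 \<le> y \<bullet> x"
  using any_closest_point_dot[OF assms(1-4), of 0] assms(5)
  by (simp add: inner_simps power2_norm_eq_inner inner_commute)

text \<open>The representing vector is a multiple of the element of minimal norm of the hyperplane on which
  the functional is \<open>1\<close>: that element is orthogonal to the kernel.\<close>

lemma riesz_representation:
  fixes L :: "'a::{real_inner,complete_space} \<Rightarrow>\<^sub>L real"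
  obtains y where "\<And>x. blinfun_apply L x = y \<bullet> x"
proof (cases "L = 0")
  case True
  then show thesis using that[of 0] by simp
next
  case False
  define S where "S = {x. blinfun_apply L x = 1}"
  obtain x0 where "blinfun_apply L x0 \<noteq> 0"
    using False by (metis blinfun_eqI zero_blinfun.rep_eq)
  then have ne: "x0 /\<^sub>R blinfun_apply L x0 \<in> S"
    by (simp add: S_def blinfun.scaleR_right)
  have S: "closed S" "convex S"
  proof -
    have "continuous_on UNIV (blinfun_apply L)"
      by (intro continuous_intros)
    then show "closed S"
      unfolding S_def by (intro closed_Collect_eq) auto
    show "convex S"
      unfolding S_def convex_def by (auto simp: blinfun.add_right blinfun.scaleR_right)
  qed
  obtain z where z: "z \<in> S" and inf: "\<And>c. c < norm z \<Longrightarrow> \<forall>x\<in>S. c < norm x"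
    using nested_convex_min_norm[of "\<lambda>_. S" "norm (x0 /\<^sub>R blinfun_apply L x0)"] S ne
    by (metis decseq_const order_refl)
  have z_min: "norm z \<le> norm x" if "x \<in> S" for x
    using inf[of "norm x"] that by (meson less_irrefl not_le)
  have Lz: "blinfun_apply L z = 1"
    using z by (simp add: S_def)
  have z_ne: "z \<noteq> 0" using Lz by auto
  have orth: "z \<bullet> h = 0" if "blinfun_apply L h = 0" for h
  proof -
    have "z + h \<in> S" "z - h \<in> S"
      using z that by (auto simp: S_def blinfun.add_right blinfun.diff_right)
    then have "(norm z)\<^sup>2 \<le> (z + h) \<bullet> z" "(norm z)\<^sup>2 \<le> (z - h) \<bullet> z"
      by (auto intro!: min_norm_inner_ge[OF S(2,1) z] z_min)
    then show ?thesis
      by (simp add: inner_simps power2_norm_eq_inner inner_commute)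
  qed
  have "blinfun_apply L x = (z /\<^sub>R (z \<bullet> z)) \<bullet> x" for x
  proof -
    have "z \<bullet> (x - blinfun_apply L x *\<^sub>R z) = 0"
      using Lz by (intro orth) (simp add: blinfun.diff_right blinfun.scaleR_right)
    then show ?thesis using z_ne by (simp add: inner_simps field_simps)
  qed
  then show thesis by (rule that)
qed

text \<open>A type variable of sort \<open>{real_inner, complete_space}\<close> does not have sort \<open>banach\<close>, although it
  satisfies the axioms of that class. The dual space does have this sort, and by the Riesz
  theorem it is a copy of the space. Facts about integrals of Banach space valued functions can thus
  be carried over along the bounded linear maps \<open>E\<close> and \<open>P\<close>.\<close>

lemma hilbert_retract_of_banach:
  obtains E :: "'a::{real_inner,complete_space} \<Rightarrow> ('a \<Rightarrow>\<^sub>L real)" and P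
  where "bounded_linear E" "bounded_linear P" "\<And>x. P (E x) = x"
proof -
  define E :: "'a \<Rightarrow> ('a \<Rightarrow>\<^sub>L real)" where "E = blinfun_inner_left"
  define P :: "('a \<Rightarrow>\<^sub>L real) \<Rightarrow> 'a" where "P L = (SOME y. \<forall>x. blinfun_apply L x = x \<bullet> y)" for L
  have E: "blinfun_apply (E y) x = x \<bullet> y" for x y
    by (simp add: E_def inner_commute)
  have P: "blinfun_apply L x = x \<bullet> P L" for L x
  proof -
    obtain y where "\<And>x. blinfun_apply L x = y \<bullet> x"
      using riesz_representation[of L] by blast
    then have "\<exists>y. \<forall>x. blinfun_apply L x = x \<bullet> y"
      by (auto simp: inner_commute)
    then show ?thesis
      unfolding P_def by (rule someI2_ex) blast
  qed
  have uniq: "y = z" if "\<And>x. x \<bullet> y = x \<bullet> z" for y z :: 'a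
    using that vector_eq_ldot by blast
  have norm_P: "norm (P L) \<le> norm L * 1" for L
  proof -
    have "norm (P L) * norm (P L) = blinfun_apply L (P L)"
      unfolding P by (metis power2_norm_eq_inner power2_eq_square)
    also have "\<dots> \<le> norm L * norm (P L)"
      using norm_blinfun[of L "P L"] by simp
    finally show ?thesis
      by (cases "P L = 0") auto
  qed
  show thesis
  proof
    show "bounded_linear E"
      unfolding E_def by (rule bounded_linear_blinfun_inner_left)
    show "P (E x) = x" for x
      by (rule uniq) (metis E P)
    show "bounded_linear P"
    proof (rule bounded_linear_intro[OF _ _ norm_P])
      show "P (L + M) = P L + P M" for L M
        by (rule uniq) (simp only: inner_add_right P[symmetric] plus_blinfun.rep_eq)
      show "P (c *\<^sub>R L) = c *\<^sub>R P L" for c L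
        by (rule uniq) (simp only: inner_scaleR_right P[symmetric] scaleR_blinfun.rep_eq real_scaleR_def)
    qed
  qed
qed

section \<open>Integration with countably many exceptional points\<close>

text \<open>The exceptional points are enumerated, and the \<open>k\<close>-th one may contribute an error of
  \<open>\<epsilon> / 2 ^ k\<close> to each interval that it tags, which continuity of \<open>F\<close> allows for. To sum these errors
  without counting intervals, they are dominated by the increments of a bounded increasing function
  \<open>m\<close> that jumps at the exceptional points; these increments telescope like those of \<open>F\<close>.\<close>

lemma fundamental_theorem_of_calculus_countable:
  fixes F :: "real \<Rightarrow> 'a::real_normed_vector"
  assumes "a \<le> b" and S: "countable S" and cont: "continuous_on {a..b} F"
    and der: "\<And>x. x \<in> {a..b} - S \<Longrightarrow> (F has_vector_derivative g x) (at x within {a..b})"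
  shows "(g has_integral F b - F a) {a..b}"
proof -
  define k where "k = to_nat_on S"
  have k_inj: "k s = k s' \<longleftrightarrow> s = s'" if "s \<in> S" "s' \<in> S" for s s'
    unfolding k_def using inj_on_to_nat_on[OF S] that by (auto dest: inj_onD)
  \<comment> \<open>Two jumps at each exceptional point, one on either side, because a tag may be an end point of its interval.\<close>
  define j where "j y n = (1/2) ^ n *
      (of_bool (\<exists>s\<in>S. k s = n \<and> s < y) + of_bool (\<exists>s\<in>S. k s = n \<and> s \<le> y) :: real)" for y n
  define m where "m y = suminf (j y)" for y
  have geom: "(\<lambda>n. 2 * (1/2) ^ n :: real) sums 4"
    using sums_mult[OF geometric_sums[of "1/2 :: real"], of 2] by simp
  have j_bounds: "0 \<le> j y n" "j y n \<le> 2 * (1/2) ^ n" for y n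
    by (auto simp: j_def of_bool_def)
  have j_summable: "summable (j y)" for y
    using j_bounds by (intro summable_comparison_test'[OF sums_summable[OF geom]]) auto
  have j_mono: "j u n \<le> j v n" if "u \<le> v" for u v n
    unfolding j_def using that by (intro mult_left_mono add_mono) (auto simp: of_bool_def)
  have m_range: "0 \<le> m y" "m y \<le> 4" for y
  proof -
    show "0 \<le> m y"
      unfolding m_def by (intro suminf_nonneg j_summable j_bounds)
    have "m y \<le> (\<Sum>n. 2 * (1/2) ^ n)"
      unfolding m_def by (intro suminf_le j_summable j_bounds sums_summable[OF geom])
    then show "m y \<le> 4"
      using sums_unique[OF geom] by simp
  qed
  have m_mono: "m u \<le> m v" if "u \<le> v" for u v
    unfolding m_def using that by (intro suminf_le j_mono j_summable)
  have m_jump: "(1/2) ^ k s \<le> m v - m u" if "s \<in> S" "u \<le> s" "s \<le> v" "u < v" for s u v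
  proof -
    have at_s: "(\<exists>s'\<in>S. k s' = k s \<and> P s') \<longleftrightarrow> P s" for P
      using that(1) k_inj by blast
    have "(1/2) ^ k s \<le> (\<Sum>n\<in>{k s}. j v n - j u n)"
      using that by (auto simp: j_def at_s of_bool_def algebra_simps)
    also have "\<dots> \<le> (\<Sum>n. j v n - j u n)"
      using j_mono that by (intro sum_le_suminf summable_diff j_summable) auto
    also have "\<dots> = m v - m u"
      unfolding m_def by (intro suminf_diff[symmetric] j_summable)
    finally show ?thesis .
  qed
  show ?thesis
    unfolding has_integral_real
  proof (intro allI impI)
    fix e :: real assume "e > 0"
    define \<epsilon> where "\<epsilon> = e / (b - a + 5)"
    have \<epsilon>: "\<epsilon> > 0" "\<epsilon> * (b - a) + \<epsilon> * 4 < e"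
    proof -
      show "\<epsilon> > 0"
        using \<open>e > 0\<close> \<open>a \<le> b\<close> by (simp add: \<epsilon>_def)
      moreover have "\<epsilon> * (b - a + 5) = e"
        using \<open>a \<le> b\<close> by (simp add: \<epsilon>_def)
      ultimately show "\<epsilon> * (b - a) + \<epsilon> * 4 < e"
        by (simp add: algebra_simps)
    qed
    have "\<exists>d>0. x \<in> {a..b} \<longrightarrow> (\<forall>y\<in>{a..b}. dist y x < d \<longrightarrow>
        norm (F y - F x - (y - x) *\<^sub>R g x) \<le> \<epsilon> / 2 * (if x \<in> S then (1/2) ^ k x else \<bar>y - x\<bar>))" for x
    proof (cases "x \<in> {a..b}")
      case x: True
      show ?thesis
      proof (cases "x \<in> S")
        case True
        have "continuous_on {a..b} (\<lambda>y. F y - F x - (y - x) *\<^sub>R g x)"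
          by (intro continuous_intros cont)
        then have "\<forall>e>0. \<exists>d>0. \<forall>y\<in>{a..b}. dist y x < d \<longrightarrow>
            dist (F y - F x - (y - x) *\<^sub>R g x) (F x - F x - (x - x) *\<^sub>R g x) < e"
          using x unfolding continuous_on_iff by (rule bspec)
        moreover have "\<epsilon> / 2 * (1/2) ^ k x > 0"
          using \<epsilon> by simp
        ultimately obtain d where "d > 0" "\<forall>y\<in>{a..b}. dist y x < d \<longrightarrow>
            dist (F y - F x - (y - x) *\<^sub>R g x) (F x - F x - (x - x) *\<^sub>R g x) < \<epsilon> / 2 * (1/2) ^ k x"
          by blast
        then show ?thesis
          using True by (intro exI[of _ d]) (auto simp: less_imp_le)
      next
        case False
        then have "(F has_derivative (\<lambda>h. h *\<^sub>R g x)) (at x within {a..b})"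
          using der x by (simp add: has_vector_derivative_def)
        then have "\<forall>e>0. \<exists>d>0. \<forall>y\<in>{a..b}. norm (y - x) < d \<longrightarrow>
            norm (F y - F x - (y - x) *\<^sub>R g x) \<le> e * norm (y - x)"
          unfolding has_derivative_within_alt by blast
        then obtain d where "d > 0" "\<forall>y\<in>{a..b}. norm (y - x) < d \<longrightarrow>
            norm (F y - F x - (y - x) *\<^sub>R g x) \<le> \<epsilon> / 2 * norm (y - x)"
          using half_gt_zero[OF \<epsilon>(1)] by blast
        then show ?thesis
          using False by (intro exI[of _ d]) (auto simp: dist_norm)
      qed
    qed (auto intro: exI[of _ 1])
    then obtain d where d: "\<And>x. d x > 0" and F_near: "\<And>x y. x \<in> {a..b} \<Longrightarrow> y \<in> {a..b} \<Longrightarrow>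
        dist y x < d x \<Longrightarrow> norm (F y - F x - (y - x) *\<^sub>R g x)
          \<le> \<epsilon> / 2 * (if x \<in> S then (1/2) ^ k x else \<bar>y - x\<bar>)"
      by metis
    have "norm ((\<Sum>(x, K)\<in>p. measure lborel K *\<^sub>R g x) - (F b - F a)) < e"
      if p: "p tagged_division_of {a..b}" and fine: "(\<lambda>x. ball x (d x)) fine p" for p
    proof -
      have piece: "norm (measure lborel K *\<^sub>R g x - (F (Sup K) - F (Inf K)))
          \<le> \<epsilon> * (Sup K - Inf K) + \<epsilon> * (m (Sup K) - m (Inf K))" if xK: "(x, K) \<in> p" for x K
      proof -
        obtain u v where K: "K = {u..v}"
          using tagged_division_ofD(4)[OF p xK] by (auto simp: box_real)
        have x: "u \<le> x" "x \<le> v" "a \<le> u" "v \<le> b"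
          using tagged_division_ofD(2,3)[OF p xK] K by auto
        have uv: "norm (F z - F x - (z - x) *\<^sub>R g x)
            \<le> \<epsilon> / 2 * (if x \<in> S then (1/2) ^ k x else \<bar>z - x\<bar>)" if "z \<in> {u, v}" for z
        proof (rule F_near)
          have "K \<subseteq> ball x (d x)"
            using fine xK by (auto simp: fine_def)
          moreover have "z \<in> K"
            using that x K by auto
          ultimately show "dist z x < d x"
            by (auto simp: dist_commute)
        qed (use that x in auto)
        have "norm ((v - u) *\<^sub>R g x - (F v - F u))
            = norm ((F u - F x - (u - x) *\<^sub>R g x) - (F v - F x - (v - x) *\<^sub>R g x))"
          by (auto simp: algebra_simps)
        also have "\<dots> \<le> norm (F u - F x - (u - x) *\<^sub>R g x) + norm (F v - F x - (v - x) *\<^sub>R g x)"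
          by (rule norm_triangle_ineq4)
        also have "\<dots> \<le> \<epsilon> / 2 * (if x \<in> S then (1/2) ^ k x else \<bar>u - x\<bar>)
            + \<epsilon> / 2 * (if x \<in> S then (1/2) ^ k x else \<bar>v - x\<bar>)"
          by (intro add_mono uv) auto
        also have "\<dots> = \<epsilon> * (if x \<in> S then (1/2) ^ k x else (v - u) / 2)"
          using x by (auto simp: field_simps)
        finally have bound: "norm ((v - u) *\<^sub>R g x - (F v - F u))
            \<le> \<epsilon> * (if x \<in> S then (1/2) ^ k x else (v - u) / 2)" .
        have "norm ((v - u) *\<^sub>R g x - (F v - F u)) \<le> \<epsilon> * ((v - u) + (m v - m u))"
        proof (cases "u = v")
          case False
          have "(if x \<in> S then (1/2) ^ k x else (v - u) / 2) \<le> (v - u) + (m v - m u)"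
            using x m_mono[of u v] m_jump[of x u v] False by auto
          then have "\<epsilon> * (if x \<in> S then (1/2) ^ k x else (v - u) / 2) \<le> \<epsilon> * ((v - u) + (m v - m u))"
            using \<epsilon>(1) by (intro mult_left_mono) auto
          then show ?thesis using bound by linarith
        qed simp
        then show ?thesis using x K by (simp add: distrib_left)
      qed
      have "(\<Sum>(x, K)\<in>p. measure lborel K *\<^sub>R g x) - (F b - F a)
          = (\<Sum>(x, K)\<in>p. measure lborel K *\<^sub>R g x - (F (Sup K) - F (Inf K)))"
        unfolding additive_tagged_division_1[OF \<open>a \<le> b\<close> p, of F, symmetric]
        by (simp add: sum_subtractf split_def)
      also have "norm \<dots> \<le> (\<Sum>(x, K)\<in>p. \<epsilon> * (Sup K - Inf K) + \<epsilon> * (m (Sup K) - m (Inf K)))"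
        using piece by (intro sum_norm_le) auto
      also have "\<dots> = \<epsilon> * (\<Sum>(x, K)\<in>p. Sup K - Inf K) + \<epsilon> * (\<Sum>(x, K)\<in>p. m (Sup K) - m (Inf K))"
        by (simp add: sum.distrib sum_distrib_left split_def)
      also have "\<dots> = \<epsilon> * (b - a) + \<epsilon> * (m b - m a)"
        using additive_tagged_division_1[OF \<open>a \<le> b\<close> p, of "\<lambda>x. x"]
          additive_tagged_division_1[OF \<open>a \<le> b\<close> p, of m] by simp
      also have "\<dots> \<le> \<epsilon> * (b - a) + \<epsilon> * 4"
        using \<epsilon>(1) m_range(1)[of a] m_range(2)[of b] by (intro add_left_mono mult_left_mono) auto
      also have "\<dots> < e" by (rule \<epsilon>(2))
      finally show ?thesis .
    qed
    then show "\<exists>\<gamma>. gauge \<gamma> \<and> (\<forall>p. p tagged_division_of {a..b} \<and> \<gamma> fine p \<longrightarrow>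
        norm ((\<Sum>(x, K)\<in>p. measure lborel K *\<^sub>R g x) - (F b - F a)) < e)"
      using d by (intro exI[of _ "\<lambda>x. ball x (d x)"]) (auto simp: gauge_ball_dependent)
  qed
qed

lemma has_vector_derivative_iff_quotient:
  "(f has_vector_derivative D) (at x within S) \<longleftrightarrow>
    ((\<lambda>y. (f y - f x) /\<^sub>R (y - x)) \<longlongrightarrow> D) (at x within S)"
proof -
  have "norm ((f y - (f x + (y - x) *\<^sub>R D)) /\<^sub>R norm (y - x)) = norm ((f y - f x) /\<^sub>R (y - x) - D)"
    if "y \<noteq> x" for y
  proof -
    have "f y - (f x + (y - x) *\<^sub>R D) = (y - x) *\<^sub>R ((f y - f x) /\<^sub>R (y - x) - D)"
      using that by (simp add: scaleR_diff_right)
    also have "norm (\<dots> /\<^sub>R norm (y - x)) = norm ((f y - f x) /\<^sub>R (y - x) - D)"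
      using that by (simp only: norm_scaleR) (simp add: field_simps)
    finally show ?thesis .
  qed
  then have "((\<lambda>y. norm ((f y - (f x + (y - x) *\<^sub>R D)) /\<^sub>R norm (y - x))) \<longlongrightarrow> 0) (at x within S) \<longleftrightarrow>
      ((\<lambda>y. norm ((f y - f x) /\<^sub>R (y - x) - D)) \<longlongrightarrow> 0) (at x within S)"
    by (intro filterlim_cong refl) (auto simp: eventually_at_filter)
  then show ?thesis
    unfolding has_vector_derivative_def has_derivative_within tendsto_norm_zero_iff Lim_null[of _ D]
    by (simp add: bounded_linear_scaleR_left inverse_eq_divide)
qed

text \<open>The approximants are cut off by continuous functions that increase to the indicator function of
  the open interval.\<close>

lemma measurable_on_interval_limit:
  fixes G :: "nat \<Rightarrow> real \<Rightarrow> 'a::real_normed_vector"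
  assumes cont: "\<And>n. continuous_on UNIV (G n)" and "countable N"
    and lim: "\<And>x. a < x \<Longrightarrow> x < b \<Longrightarrow> x \<notin> N \<Longrightarrow> (\<lambda>n. G n x) \<longlonglongrightarrow> f x"
  shows "f measurable_on {a..b}"
proof -
  define cut where "cut n x = max 0 (min 1 (real n * min (x - a) (b - x)))" for n x
  have "continuous_on UNIV (\<lambda>x. cut n x *\<^sub>R G n x)" for n
    unfolding cut_def by (intro continuous_intros cont)
  moreover have "(\<lambda>n. cut n x *\<^sub>R G n x) \<longlonglongrightarrow> (if x \<in> {a..b} then f x else 0)"
    if x: "x \<notin> N \<union> {a, b}" for x
  proof (cases "x \<in> {a<..<b}")
    case True
    then have c: "min (x - a) (b - x) > 0" by auto
    obtain n0 where "1 < real n0 * min (x - a) (b - x)"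
      using reals_Archimedean3[OF c] by blast
    then have "cut n x = 1" if "n \<ge> n0" for n
      using mult_right_mono[of "real n0" "real n" "min (x - a) (b - x)"] that c
      by (simp only: cut_def) linarith
    then have "(\<lambda>n. cut n x) \<longlonglongrightarrow> 1"
      by (intro tendsto_eventually) (auto simp: eventually_sequentially)
    from tendsto_scaleR[OF this lim] True x show ?thesis by auto
  next
    case False
    with x have "min (x - a) (b - x) \<le> 0" "x \<notin> {a..b}" by auto
    then have "cut n x = 0" for n
      using mult_nonneg_nonpos[of "real n" "min (x - a) (b - x)"] by (simp only: cut_def) simp
    then show ?thesis using \<open>x \<notin> {a..b}\<close> by (simp only: scaleR_zero_left if_False tendsto_const)
  qed
  moreover have "negligible (N \<union> {a, b})"
    using \<open>countable N\<close> by (intro negligible_iff_null_sets[THEN iffD2]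
        null_sets_completionI countable_imp_null_set_lborel) auto
  ultimately show ?thesis
    unfolding measurable_on_def
    by (intro exI[of _ "N \<union> {a, b}"] exI[of _ "\<lambda>n x. cut n x *\<^sub>R G n x"]) blast
qed

lemma locally_bochner_integrable_posI:
  fixes g :: "real \<Rightarrow> 'a::real_normed_vector"
  assumes meas: "\<And>a b. 0 < a \<Longrightarrow> a \<le> b \<Longrightarrow> g measurable_on {a..b}"
    and bdd: "\<And>a b. 0 < a \<Longrightarrow> a \<le> b \<Longrightarrow> bounded (g ` {a..b})"
  shows "locally_bochner_integrable_pos g"
  unfolding locally_bochner_integrable_pos_def
proof (intro allI impI conjI)
  fix a b :: real assume ab: "0 < a \<and> a \<le> b"
  then show m: "g measurable_on {a..b}" using meas by blast
  obtain B where B: "\<And>x. x \<in> {a..b} \<Longrightarrow> norm (g x) \<le> B"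
    using bdd ab by (force simp: bounded_iff)
  have "(norm \<circ> g) measurable_on {a..b}"
    using m by (intro measurable_on_compose_continuous_0 continuous_intros) auto
  then have "(\<lambda>x. norm (g x)) \<in> borel_measurable (lebesgue_on {a..b})"
    by (intro measurable_on_imp_borel_measurable_lebesgue) (auto simp: o_def)
  then show "(\<lambda>x. norm (g x)) integrable_on {a..b}"
    by (rule measurable_bounded_by_integrable_imp_integrable[where g = "\<lambda>_. B"])
       (use B in \<open>auto simp: integrable_const_ivl\<close>)
qed

text \<open>The product \<open>\<phi> r\<close> vanishes at the ends of an interval slightly larger than the support of \<open>\<phi>\<close>, so
  the integral of its derivative there is \<open>0\<close>.\<close>

lemma integration_by_parts_test_function:
  fixes r g :: "real \<Rightarrow> 'a::banach"
  assumes cont: "continuous_on {0<..} r" and "countable D"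
    and der: "\<And>x. x > 0 \<Longrightarrow> x \<notin> D \<Longrightarrow> (r has_vector_derivative g x) (at x)"
    and \<phi>: "test_function_pos \<phi>"
  shows "\<exists>I. ((\<lambda>x. deriv \<phi> x *\<^sub>R r x) has_integral I) {0<..} \<and>
             ((\<lambda>x. \<phi> x *\<^sub>R g x) has_integral - I) {0<..}"
proof -
  obtain a b where ab: "0 < a" "a \<le> b" and supp: "\<And>x. x \<notin> {a..b} \<Longrightarrow> \<phi> x = 0"
    using \<phi> unfolding test_function_pos_def by blast
  have diff: "(deriv ^^ k) \<phi> differentiable (at x)" for k x
    using \<phi> unfolding test_function_pos_def by blast
  have \<phi>_der: "(\<phi> has_real_derivative deriv \<phi> x) (at x)" for x
    using diff[of 0 x] by (simp add: DERIV_deriv_iff_real_differentiable)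
  have \<phi>_cont: "continuous_on A \<phi>" for A
    using DERIV_isCont[OF \<phi>_der] by (simp add: continuous_at_imp_continuous_on)
  have \<phi>'_cont: "continuous_on A (deriv \<phi>)" for A
    using differentiable_imp_continuous_within[OF diff[of 1]]
    by (simp add: continuous_at_imp_continuous_on)
  have supp': "deriv \<phi> x = 0" if "x \<notin> {a..b}" for x
  proof -
    have "(\<phi> has_real_derivative 0) (at x)"
    proof (rule has_field_derivative_transform_within_open)
      show "((\<lambda>_. 0) has_real_derivative 0) (at x)" by simp
      show "open (- {a..b})" by (intro open_Compl closed_atLeastAtMost)
      show "x \<in> - {a..b}" using that by simp
      show "0 = \<phi> y" if "y \<in> - {a..b}" for y using supp that by simp
    qed
    then show ?thesis by (rule DERIV_imp_deriv)
  qed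
  define c d where "c = a / 2" and "d = b + 1"
  have cd: "0 < c" "c < a" "b < d" "c \<le> d" "{c..d} \<subseteq> {0<..}"
    using ab by (auto simp: c_def d_def)
  have r_cont: "continuous_on {c..d} r"
    using cont cd continuous_on_subset by blast
  define I where "I = integral {c..d} (\<lambda>x. deriv \<phi> x *\<^sub>R r x)"
  have I: "((\<lambda>x. deriv \<phi> x *\<^sub>R r x) has_integral I) {c..d}"
    unfolding I_def
    by (intro integrable_integral integrable_continuous_real continuous_intros \<phi>'_cont r_cont)
  have "((\<lambda>x. \<phi> x *\<^sub>R g x + deriv \<phi> x *\<^sub>R r x) has_integral \<phi> d *\<^sub>R r d - \<phi> c *\<^sub>R r c) {c..d}"
  proof (rule fundamental_theorem_of_calculus_countable[OF \<open>c \<le> d\<close> \<open>countable D\<close>])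
    show "continuous_on {c..d} (\<lambda>x. \<phi> x *\<^sub>R r x)"
      by (intro continuous_intros \<phi>_cont r_cont)
    fix x assume "x \<in> {c..d} - D"
    then show "((\<lambda>x. \<phi> x *\<^sub>R r x) has_vector_derivative \<phi> x *\<^sub>R g x + deriv \<phi> x *\<^sub>R r x)
        (at x within {c..d})"
      using cd by (intro has_vector_derivative_at_within[OF has_vector_derivative_scaleR[OF \<phi>_der der]]) auto
  qed
  moreover have "\<phi> c = 0" "\<phi> d = 0"
    using supp cd ab by auto
  ultimately have "((\<lambda>x. \<phi> x *\<^sub>R g x) has_integral - I) {c..d}"
    using has_integral_diff[OF _ I, of "\<lambda>x. \<phi> x *\<^sub>R g x + deriv \<phi> x *\<^sub>R r x" 0] by simp
  then have "((\<lambda>x. \<phi> x *\<^sub>R g x) has_integral - I) {0<..}"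
  proof (rule has_integral_on_superset[OF _ _ cd(5)])
    show "\<phi> x *\<^sub>R g x = 0" if "x \<notin> {c..d}" for x
    proof -
      have "x \<notin> {a..b}" using that cd by auto
      then show ?thesis using supp by simp
    qed
  qed
  moreover have "((\<lambda>x. deriv \<phi> x *\<^sub>R r x) has_integral I) {0<..}"
  proof (rule has_integral_on_superset[OF I _ cd(5)])
    show "deriv \<phi> x *\<^sub>R r x = 0" if "x \<notin> {c..d}" for x
    proof -
      have "x \<notin> {a..b}" using that cd by auto
      then show ?thesis using supp' by simp
    qed
  qed
  ultimately show ?thesis by blast
qed

text \<open>Strong measurability of \<open>g\<close> holds since \<open>g\<close> is an almost everywhere limit of difference quotients
  of the continuous function \<open>r\<close>. The two integrals are computed in the dual space and transported
  back.\<close>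

lemma has_weak_derivative_posI:
  fixes r g :: "real \<Rightarrow> 'a::{real_inner,complete_space}"
  assumes cont: "continuous_on {0<..} r" and "countable D"
    and der: "\<And>x. x > 0 \<Longrightarrow> x \<notin> D \<Longrightarrow> (r has_vector_derivative g x) (at x)"
    and bdd: "\<And>a b. 0 < a \<Longrightarrow> a \<le> b \<Longrightarrow> bounded (g ` {a..b})"
  shows "has_weak_derivative_pos r g"
  unfolding has_weak_derivative_pos_def
proof (intro conjI allI impI)
  have r_cont: "continuous_on {a..b} r" if "0 < a" for a b
    using cont that by (auto intro: continuous_on_subset)
  have clamp_cont: "continuous_on UNIV (\<lambda>x. r (max a (x + s)))" if "0 < a" for a s
    by (rule continuous_on_compose2[OF cont]) (use that in \<open>auto intro!: continuous_intros\<close>)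
  show "locally_bochner_integrable_pos r"
  proof (rule locally_bochner_integrable_posI)
    fix a b :: real assume ab: "0 < a" "a \<le> b"
    show "r measurable_on {a..b}"
      by (rule measurable_on_interval_limit[of "\<lambda>_ x. r (max a (x + 0))" "{}"])
         (use clamp_cont[of a 0] ab in \<open>auto simp: max_def\<close>)
    show "bounded (r ` {a..b})"
      using r_cont[OF ab(1)] by (intro compact_imp_bounded compact_continuous_image) auto
  qed
  show "locally_bochner_integrable_pos g"
  proof (rule locally_bochner_integrable_posI[OF _ bdd])
    fix a b :: real assume ab: "0 < a" "a \<le> b"
    show "g measurable_on {a..b}"
    proof (rule measurable_on_interval_limit[OF _ \<open>countable D\<close>])
      show "continuous_on UNIV (\<lambda>x. real (Suc n) *\<^sub>R
          (r (max a (x + inverse (real (Suc n)))) - r (max a (x + 0))))" for n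
        by (intro continuous_intros clamp_cont ab)
      fix x assume x: "a < x" "x < b" "x \<notin> D"
      have lim: "((\<lambda>y. (r y - r x) /\<^sub>R (y - x)) \<longlongrightarrow> g x) (at x)"
        using der[of x] x ab by (simp add: has_vector_derivative_iff_quotient)
      have "(\<lambda>n. x + inverse (real (Suc n))) \<longlonglongrightarrow> x"
        using tendsto_add[OF tendsto_const LIMSEQ_inverse_real_of_nat] by simp
      then have "filterlim (\<lambda>n. x + inverse (real (Suc n))) (at x) sequentially"
        by (simp add: filterlim_at)
      from filterlim_compose[OF lim this]
      have "(\<lambda>n. real (Suc n) *\<^sub>R (r (x + inverse (real (Suc n))) - r x)) \<longlonglongrightarrow> g x"
        by simp
      moreover have "max a (x + inverse (real (Suc n))) = x + inverse (real (Suc n))" "max a (x + 0) = x" for n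
        using x by (auto simp: max_def add_increasing2 less_imp_le)
      ultimately show "(\<lambda>n. real (Suc n) *\<^sub>R
          (r (max a (x + inverse (real (Suc n)))) - r (max a (x + 0)))) \<longlonglongrightarrow> g x"
        by (simp only:)
    qed
  qed
  fix \<phi> assume \<phi>: "test_function_pos \<phi>"
  obtain E :: "'a \<Rightarrow> ('a \<Rightarrow>\<^sub>L real)" and P
    where E: "bounded_linear E" and P: "bounded_linear P" and PE: "\<And>x. P (E x) = x"
    by (rule hilbert_retract_of_banach) blast
  interpret P: bounded_linear P by (rule P)
  have "\<exists>I. ((\<lambda>x. deriv \<phi> x *\<^sub>R E (r x)) has_integral I) {0<..} \<and>
            ((\<lambda>x. \<phi> x *\<^sub>R E (g x)) has_integral - I) {0<..}"
    by (rule integration_by_parts_test_function[OF _ \<open>countable D\<close> _ \<phi>])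
       (use cont der in \<open>auto intro!: bounded_linear.continuous_on[OF E]
          bounded_linear.has_vector_derivative[OF E]\<close>)
  then obtain I where I: "((\<lambda>x. deriv \<phi> x *\<^sub>R E (r x)) has_integral I) {0<..}"
      "((\<lambda>x. \<phi> x *\<^sub>R E (g x)) has_integral - I) {0<..}"
    by blast
  show "\<exists>I. ((\<lambda>x. deriv \<phi> x *\<^sub>R r x) has_integral I) {0<..} \<and>
            ((\<lambda>x. \<phi> x *\<^sub>R g x) has_integral - I) {0<..}"
    using has_integral_linear[OF I(1) P] has_integral_linear[OF I(2) P]
    by (intro exI[of _ "P I"]) (simp add: o_def P.scaleR P.neg PE)
qed

section \<open>Monotonicity from right slopes\<close>

text \<open>For each slope \<open>e > 0\<close> the points at which \<open>g\<close> lies below the line of slope \<open>e\<close> through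
  \<open>(a, g a)\<close> form a compact set, and its largest element can only be \<open>b\<close>.\<close>

lemma upper_right_derivative_nonpos_imp_le:
  fixes g :: "real \<Rightarrow> real"
  assumes "a \<le> b" and cont: "continuous_on {a..b} g"
    and der: "\<And>t e. a \<le> t \<Longrightarrow> t < b \<Longrightarrow> e > 0 \<Longrightarrow>
      \<forall>\<^sub>F s in at_right t. g s \<le> g t + e * (s - t)"
  shows "g b \<le> g a"
proof (rule field_le_epsilon)
  fix \<epsilon> :: real assume "\<epsilon> > 0"
  define e where "e = \<epsilon> / (b - a + 1)"
  have e: "e > 0" "e * (b - a) \<le> \<epsilon>"
    using \<open>\<epsilon> > 0\<close> \<open>a \<le> b\<close> by (auto simp: e_def field_simps)
  define A where "A = {t\<in>{a..b}. g t \<le> g a + e * (t - a)}"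
  have "closed A"
    unfolding A_def
    by (intro continuous_on_closed_Collect_le cont continuous_intros closed_atLeastAtMost)
  moreover have "bounded A"
    unfolding A_def by (rule bounded_subset[OF bounded_closed_interval[of a b]]) auto
  moreover have "a \<in> A"
    using \<open>a \<le> b\<close> by (auto simp: A_def)
  ultimately obtain c where c: "c \<in> A" "\<And>t. t \<in> A \<Longrightarrow> t \<le> c"
    using compact_attains_sup[of A] compact_eq_bounded_closed by auto
  have "c = b"
  proof (rule ccontr)
    assume "c \<noteq> b"
    then have "a \<le> c" "c < b" "g c \<le> g a + e * (c - a)"
      using c(1) by (auto simp: A_def)
    then have "\<forall>\<^sub>F s in at_right c. g s \<le> g c + e * (s - c) \<and> c < s \<and> s < b"
      using der[OF _ _ e(1)] \<open>c < b\<close>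
      by (intro eventually_conj) (auto simp: eventually_at_right_less eventually_at_right_field)
    then obtain s where "g s \<le> g c + e * (s - c)" "c < s" "s < b"
      using eventually_happens[of _ "at_right c"] trivial_limit_at_right_real by blast
    with \<open>a \<le> c\<close> \<open>g c \<le> _\<close> have "s \<in> A"
      by (auto simp: A_def algebra_simps)
    with c(2) \<open>c < s\<close> show False by force
  qed
  then show "g b \<le> g a + \<epsilon>"
    using c(1) e(2) by (auto simp: A_def)
qed

text \<open>The form in which the criterion is applied: the increments are bounded by expressions whose right
  limits are known, while the right derivative of \<open>h\<close> itself need not exist.\<close>

lemma nonincreasing_by_right_slopes:
  fixes h :: "real \<Rightarrow> real"
  assumes "a \<le> b" and cont: "continuous_on {a..b} h"
    and slope: "\<And>t s. a \<le> t \<Longrightarrow> t < s \<Longrightarrow> s \<le> b \<Longrightarrow> h s - h t \<le> (s - t) * m t s"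
    and lim: "\<And>t. a \<le> t \<Longrightarrow> t < b \<Longrightarrow> (m t \<longlongrightarrow> l t) (at_right t)"
    and nonpos: "\<And>t. a \<le> t \<Longrightarrow> t < b \<Longrightarrow> l t \<le> 0"
  shows "h b \<le> h a"
proof (rule upper_right_derivative_nonpos_imp_le[OF \<open>a \<le> b\<close> cont])
  fix t e :: real assume t: "a \<le> t" "t < b" and "e > 0"
  have "\<forall>\<^sub>F s in at_right t. m t s < e"
    using order_tendstoD(2)[OF lim[OF t], of e] nonpos[OF t] \<open>e > 0\<close> by simp
  moreover have "\<forall>\<^sub>F s in at_right t. t < s \<and> s < b"
    using eventually_at_right_less[of t] eventually_at_right_field[of "\<lambda>s. s < b" t] t
    by (auto intro!: eventually_conj)
  ultimately show "\<forall>\<^sub>F s in at_right t. h s \<le> h t + e * (s - t)"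
  proof eventually_elim
    case (elim s)
    then have "(s - t) * m t s \<le> e * (s - t)"
      unfolding mult.commute[of e] by (intro mult_left_mono) auto
    then show ?case
      using slope[of t s] t elim by linarith
  qed
qed

section \<open>Absolutely one-homogeneous functionals\<close>

lemma inner_difference_quotient:
  fixes x :: "'a::real_inner"
  assumes "(c::real) \<noteq> 0"
  shows "c * ((x /\<^sub>R c) \<bullet> y) = x \<bullet> y" "c * (y \<bullet> (x /\<^sub>R c)) = y \<bullet> x"
  using assms by simp_all

lemma class_C_scale: "class_C J \<Longrightarrow> c \<noteq> 0 \<Longrightarrow> J (c *\<^sub>R x) = ereal \<bar>c\<bar> * J x"
  by (simp add: class_C_def)

lemma class_C_minus: "class_C J \<Longrightarrow> J (- x) = J x"
  using class_C_scale[of J "-1" x] by (simp add: one_ereal_def[symmetric])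

lemma mem_subdiff_0_iff:
  assumes "class_C J"
  shows "z \<in> subdiff J 0 \<longleftrightarrow> (\<forall>x. ereal (z \<bullet> x) \<le> J x)"
  using assms by (simp add: subdiff_def class_C_def zero_ereal_def)

lemma mem_subdiff_iff:
  assumes "class_C J"
  shows "z \<in> subdiff J x \<longleftrightarrow> z \<in> subdiff J 0 \<and> ereal (z \<bullet> x) = J x"
  unfolding mem_subdiff_0_iff[OF assms] by (auto simp: subdiff_def)

lemma closed_convex_subdiff_0:
  assumes J: "class_C J"
  shows "closed (subdiff J 0)" "convex (subdiff J 0)"
proof -
  have slice: "closed {z. ereal (z \<bullet> x) \<le> J x} \<and> convex {z. ereal (z \<bullet> x) \<le> J x}" for x
  proof (cases "J x")
    case (real c)
    then have "{z. ereal (z \<bullet> x) \<le> J x} = {z. x \<bullet> z \<le> c}"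
      by (auto simp: inner_commute)
    then show ?thesis by (simp add: closed_halfspace_le convex_halfspace_le)
  next
    case PInf
    then show ?thesis by simp
  next
    case MInf
    then show ?thesis using J by (simp add: class_C_def)
  qed
  have eq: "subdiff J 0 = (\<Inter>x. {z. ereal (z \<bullet> x) \<le> J x})"
    using mem_subdiff_0_iff[OF J] by auto
  show "closed (subdiff J 0)" "convex (subdiff J 0)"
    unfolding eq using slice by (auto intro!: closed_INT convex_INT)
qed

lemma closed_convex_subdiff:
  assumes J: "class_C J"
  shows "closed (subdiff J x)" "convex (subdiff J x)"
proof -
  have "closed (subdiff J x) \<and> convex (subdiff J x)"
  proof (cases "subdiff J x = {}")
    case False
    then obtain y where "ereal (y \<bullet> x) = J x"
      by (auto simp: subdiff_def)
    then have "subdiff J x = subdiff J 0 \<inter> {z. x \<bullet> z = y \<bullet> x}"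
      using mem_subdiff_iff[OF J, of _ x] by (auto simp: inner_commute simp flip: \<open>_ = J x\<close>)
    then show ?thesis
      using closed_convex_subdiff_0[OF J] by (auto intro: closed_Int closed_hyperplane convex_Int convex_hyperplane)
  qed auto
  then show "closed (subdiff J x)" "convex (subdiff J x)" by auto
qed

lemma class_C_add_le:
  assumes J: "class_C J"
  shows "J (x + y) \<le> J x + J y"
proof -
  have half: "ereal (1/2) * J (2 *\<^sub>R z) = J z" for z
    by (subst class_C_scale[OF J]) (cases "J z"; simp)+
  have conv: "\<forall>u v. \<forall>s. 0 < s \<and> s < 1 \<longrightarrow>
      J ((1 - s) *\<^sub>R u + s *\<^sub>R v) \<le> ereal (1 - s) * J u + ereal s * J v"
    using J unfolding class_C_def by blast
  have "J ((1 - 1/2) *\<^sub>R (2 *\<^sub>R x) + (1/2) *\<^sub>R (2 *\<^sub>R y))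
      \<le> ereal (1 - 1/2) * J (2 *\<^sub>R x) + ereal (1/2) * J (2 *\<^sub>R y)"
    by (intro conv[rule_format]) auto
  then show ?thesis using half by simp
qed

lemma class_C_nonneg:
  assumes J: "class_C J"
  shows "0 \<le> J x"
proof -
  have "0 \<le> J x + J (- x)"
    using class_C_add_le[OF J, of x "- x"] J by (simp add: class_C_def)
  then show ?thesis
    unfolding class_C_minus[OF J] by (cases "J x") auto
qed

text \<open>Lower semicontinuity along a filter, in the form needed to bound \<open>J\<close> at a limit point.\<close>

lemma class_C_le_of_tendsto:
  assumes J: "class_C J" and u: "(u \<longlongrightarrow> L) F" and "F \<noteq> bot"
    and bound: "\<forall>\<^sub>F t in F. J (u t) \<le> ereal (b t)" and b: "(b \<longlongrightarrow> c) F"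
  shows "J L \<le> ereal c"
proof (rule ccontr)
  assume "\<not> J L \<le> ereal c"
  then have "ereal c < J L"
    by simp
  then obtain y where y: "ereal c < y" "y < J L"
    using dense[of "ereal c" "J L"] by auto
  have "J L \<le> Liminf (at L) J"
    using J unfolding class_C_def by blast
  then have "y < Liminf (at L) J"
    by (rule less_le_trans[OF y(2)])
  then have "\<forall>\<^sub>F x in at L. y < J x"
    using less_LiminfD by blast
  then have "\<forall>\<^sub>F x in nhds L. y < J x"
    using y(2) by (simp add: eventually_nhds_conv_at)
  then have "\<forall>\<^sub>F t in F. y < J (u t)"
    using u unfolding filterlim_iff by blast
  moreover have "\<forall>\<^sub>F t in F. ereal (b t) < y"
    using b y(1) by (intro order_tendstoD(2)[of "\<lambda>t. ereal (b t)"]) auto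
  ultimately have "\<forall>\<^sub>F t in F. False"
    using bound by eventually_elim auto
  then show False using \<open>F \<noteq> bot\<close> by simp
qed

text \<open>The difference of two candidates would be orthogonal to both of them, hence to itself.\<close>

lemma orth_proj_eqI:
  assumes "y \<in> S" "\<And>z. z \<in> S \<Longrightarrow> (x - y) \<bullet> z = 0"
  shows "orth_proj S x = y"
  unfolding orth_proj_def
proof (rule the_equality)
  show "y \<in> S \<and> (\<forall>z\<in>S. orthogonal (x - y) z)"
    using assms by (simp add: orthogonal_def)
  fix y' assume y': "y' \<in> S \<and> (\<forall>z\<in>S. orthogonal (x - y') z)"
  then have "(x - y') \<bullet> y = 0" "(x - y') \<bullet> y' = 0" "(x - y) \<bullet> y = 0" "(x - y) \<bullet> y' = 0"
    using assms by (auto simp: orthogonal_def)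
  then have "(y' - y) \<bullet> (y' - y) = 0"
    by (simp add: inner_simps inner_commute)
  then show "y' = y" by simp
qed

section \<open>Gradient flows that generate eigenvectors\<close>

locale eigenvector_flow =
  fixes J :: "'a::{real_inner,complete_space} \<Rightarrow> ereal" and f :: 'a and u p :: "real \<Rightarrow> 'a"
  assumes J: "class_C J" and flow: "gradient_flow J f u p"
    and eigenvector: "\<And>t. t > 0 \<Longrightarrow> p t \<in> subdiff J (p t)"
begin

lemma u_0: "u 0 = f"
  using flow by (simp add: gradient_flow_def)

lemma u_continuous: "continuous_on {0..} u"
  using flow by (simp add: gradient_flow_def)

lemma u_isCont: "isCont u t" if "t > 0"
  using continuous_on_interior[OF u_continuous, of t] that by simp

lemma u_slope: "((\<lambda>s. (u s - u t) /\<^sub>R (s - t)) \<longlongrightarrow> - p t) (at_right t)" if "t > 0"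
  using flow that unfolding has_vector_derivative_iff_quotient[symmetric] by (simp add: gradient_flow_def)

lemma p_in_subdiff: "p t \<in> subdiff J (u t)" if "t > 0"
  using flow that by (simp add: gradient_flow_def is_arg_min_def)

lemma p_min_norm: "norm (p t) \<le> norm z" if "t > 0" "z \<in> subdiff J (u t)"
  using flow that unfolding gradient_flow_def is_arg_min_def by (meson not_le)

lemma p_in_subdiff_0: "p t \<in> subdiff J 0" if "t > 0"
  using p_in_subdiff[OF that] mem_subdiff_iff[OF J] by blast

lemma J_u: "J (u t) = ereal (p t \<bullet> u t)" if "t > 0"
  using p_in_subdiff[OF that] by (simp add: subdiff_def)

lemma inner_u_le: "z \<bullet> u t \<le> p t \<bullet> u t" if "t > 0" "z \<in> subdiff J 0"
proof -
  have "ereal (z \<bullet> u t) \<le> J (u t)"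
    using that(2) mem_subdiff_0_iff[OF J] by blast
  then show ?thesis using J_u[OF that(1)] by simp
qed

text \<open>The eigenvector property in the form in which it is used: the left-hand side is at most
  \<open>J (p t)\<close>, which equals \<open>(norm (p t))\<^sup>2\<close>.\<close>

lemma inner_p_le: "z \<bullet> p t \<le> (norm (p t))\<^sup>2" if "t > 0" "z \<in> subdiff J 0"
proof -
  have "ereal (p t \<bullet> p t) = J (p t)"
    using eigenvector[OF that(1)] by (simp add: subdiff_def)
  moreover have "ereal (z \<bullet> p t) \<le> J (p t)"
    using that(2) mem_subdiff_0_iff[OF J] by blast
  ultimately show ?thesis
    unfolding power2_norm_eq_inner by (metis ereal_less_eq(3))
qed

text \<open>This is the variational inequality for the element of minimal norm; together with \<open>inner_p_le\<close> it
  is an equality for every subgradient at \<open>u t\<close>.\<close>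

lemma inner_p_ge: "(norm (p t))\<^sup>2 \<le> z \<bullet> p t" if "t > 0" "z \<in> subdiff J (u t)"
  using that p_in_subdiff p_min_norm by (intro min_norm_inner_ge[OF closed_convex_subdiff(2,1)[OF J]])

text \<open>The right-hand derivative of \<open>u \<sigma> \<bullet> x\<close> is \<open>- (p \<sigma> \<bullet> x)\<close>. This lemma takes the place of writing
  \<open>u s - u t\<close> as an integral of \<open>p\<close>.\<close>

lemma inner_decrease_le:
  assumes "0 < s" "s \<le> t" and c: "\<And>\<sigma>. s \<le> \<sigma> \<Longrightarrow> \<sigma> < t \<Longrightarrow> p \<sigma> \<bullet> x \<le> c"
  shows "(u s - u t) \<bullet> x \<le> c * (t - s)"
proof -
  have "- (u t \<bullet> x) - c * t \<le> - (u s \<bullet> x) - c * s"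
  proof (rule nonincreasing_by_right_slopes[OF \<open>s \<le> t\<close>])
    show "continuous_on {s..t} (\<lambda>\<sigma>. - (u \<sigma> \<bullet> x) - c * \<sigma>)"
      using \<open>0 < s\<close> by (intro continuous_intros continuous_on_subset[OF u_continuous]) auto
    show "- (u y \<bullet> x) - c * y - (- (u \<sigma> \<bullet> x) - c * \<sigma>)
        \<le> (y - \<sigma>) * (- (((u y - u \<sigma>) /\<^sub>R (y - \<sigma>)) \<bullet> x) - c)" if "\<sigma> < y" for \<sigma> y
    proof -
      have "(y - \<sigma>) * (((u y - u \<sigma>) /\<^sub>R (y - \<sigma>)) \<bullet> x) = (u y - u \<sigma>) \<bullet> x"
        using that by (intro inner_difference_quotient) simp
      then show ?thesis
        by (simp only: right_diff_distrib mult_minus_right) (simp add: inner_simps algebra_simps)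
    qed
    show "((\<lambda>y. - (((u y - u \<sigma>) /\<^sub>R (y - \<sigma>)) \<bullet> x) - c) \<longlongrightarrow> - (- p \<sigma> \<bullet> x) - c) (at_right \<sigma>)"
      if "s \<le> \<sigma>" for \<sigma>
      using that \<open>0 < s\<close> by (intro tendsto_intros u_slope) auto
    show "- (- p \<sigma> \<bullet> x) - c \<le> 0" if "s \<le> \<sigma>" "\<sigma> < t" for \<sigma>
      using c[OF that] by simp
  qed
  then show ?thesis by (simp add: inner_simps algebra_simps)
qed

text \<open>The flow is contractive: by monotonicity of the subdifferential the distance of two solutions,
  here \<open>u\<close> and its time shift, does not increase.\<close>

lemma norm_increment_mono:
  assumes "0 < s" "s \<le> t" "0 < h"
  shows "norm (u (t + h) - u t) \<le> norm (u (s + h) - u s)"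
proof -
  define d where "d \<sigma> = u (\<sigma> + h) - u \<sigma>" for \<sigma>
  have d_isCont: "isCont d \<sigma>" if "\<sigma> > 0" for \<sigma>
  proof -
    have "isCont (\<lambda>y. u (y + h)) \<sigma>"
      by (rule isCont_o2[of _ "\<lambda>y. y + h" u]) (use that \<open>0 < h\<close> in \<open>auto intro: u_isCont\<close>)
    then show ?thesis
      unfolding d_def using u_isCont[OF that] by (rule continuous_diff)
  qed
  have d_lim: "(d \<longlongrightarrow> d \<sigma>) (at_right \<sigma>)" if "\<sigma> > 0" for \<sigma>
    using d_isCont[OF that] by (simp add: isCont_def filterlim_at_split)
  have shifted: "((\<lambda>y. (u (y + h) - u (\<sigma> + h)) /\<^sub>R (y - \<sigma>)) \<longlongrightarrow> - p (\<sigma> + h)) (at_right \<sigma>)" if "\<sigma> > 0" for \<sigma>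
    using u_slope[of "\<sigma> + h"] that \<open>0 < h\<close>
    unfolding filterlim_at_right_to_0[of _ _ "\<sigma> + h"] filterlim_at_right_to_0[of _ _ \<sigma>]
    by (simp add: add.assoc)
  have d_slope: "((\<lambda>y. (d y - d \<sigma>) /\<^sub>R (y - \<sigma>)) \<longlongrightarrow> - p (\<sigma> + h) - - p \<sigma>) (at_right \<sigma>)" if "\<sigma> > 0" for \<sigma>
    using tendsto_diff[OF shifted[OF that] u_slope[OF that]]
    by (simp add: d_def diff_diff_eq2 flip: scaleR_diff_right) (simp add: algebra_simps)
  have "(norm (d t))\<^sup>2 \<le> (norm (d s))\<^sup>2"
  proof (rule nonincreasing_by_right_slopes[OF \<open>s \<le> t\<close>])
    show "continuous_on {s..t} (\<lambda>\<sigma>. (norm (d \<sigma>))\<^sup>2)"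
      using \<open>0 < s\<close> by (intro continuous_at_imp_continuous_on ballI continuous_intros d_isCont) auto
    show "(norm (d y))\<^sup>2 - (norm (d \<sigma>))\<^sup>2 \<le> (y - \<sigma>) * (((d y - d \<sigma>) /\<^sub>R (y - \<sigma>)) \<bullet> (d y + d \<sigma>))"
      if "\<sigma> < y" for \<sigma> y
    proof -
      have "(y - \<sigma>) * (((d y - d \<sigma>) /\<^sub>R (y - \<sigma>)) \<bullet> (d y + d \<sigma>)) = (d y - d \<sigma>) \<bullet> (d y + d \<sigma>)"
        using that by (intro inner_difference_quotient) simp
      then show ?thesis
        by (simp only: power2_norm_eq_inner) (simp add: inner_simps inner_commute)
    qed
    show "((\<lambda>y. ((d y - d \<sigma>) /\<^sub>R (y - \<sigma>)) \<bullet> (d y + d \<sigma>))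
        \<longlongrightarrow> (- p (\<sigma> + h) - - p \<sigma>) \<bullet> (d \<sigma> + d \<sigma>)) (at_right \<sigma>)" if "s \<le> \<sigma>" for \<sigma>
      using that \<open>0 < s\<close> by (intro tendsto_intros d_slope d_lim) auto
    show "(- p (\<sigma> + h) - - p \<sigma>) \<bullet> (d \<sigma> + d \<sigma>) \<le> 0" if "s \<le> \<sigma>" for \<sigma>
    proof -
      have "p \<sigma> \<bullet> u (\<sigma> + h) \<le> p (\<sigma> + h) \<bullet> u (\<sigma> + h)" "p (\<sigma> + h) \<bullet> u \<sigma> \<le> p \<sigma> \<bullet> u \<sigma>"
        using that \<open>0 < s\<close> \<open>0 < h\<close> by (intro inner_u_le p_in_subdiff_0; simp)+
      then show ?thesis by (simp add: d_def inner_simps)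
    qed
  qed
  then show ?thesis
    unfolding d_def by (rule power2_le_imp_le) simp
qed

text \<open>Divide the previous inequality by \<open>h\<close> and let \<open>h\<close> tend to \<open>0\<close>.\<close>

lemma norm_p_mono:
  assumes "0 < s" "s \<le> t"
  shows "norm (p t) \<le> norm (p s)"
proof -
  have slope: "((\<lambda>h. norm ((u (\<sigma> + h) - u \<sigma>) /\<^sub>R h)) \<longlongrightarrow> norm (- p \<sigma>)) (at_right 0)" if "\<sigma> > 0" for \<sigma>
    using u_slope[OF that] unfolding filterlim_at_right_to_0[of _ _ \<sigma>]
    by (intro tendsto_norm) (simp add: add.commute)
  have "\<forall>\<^sub>F h in at_right 0. norm ((u (t + h) - u t) /\<^sub>R h) \<le> norm ((u (s + h) - u s) /\<^sub>R h)"
    using eventually_at_right_less[of 0]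
  proof eventually_elim
    case (elim h)
    then show ?case
      using norm_increment_mono[OF assms, of h] by (simp add: mult_left_mono)
  qed
  then have "norm (- p t) \<le> norm (- p s)"
    using assms by (intro tendsto_le[OF _ slope slope]) auto
  then show ?thesis by simp
qed

text \<open>The sets \<open>S n\<close> in the proof are \<open>\<epsilon>\<close>-subdifferentials of \<open>J\<close> at \<open>u t\<close>, with intersection
  \<open>subdiff J (u t)\<close>. For \<open>s\<close> slightly larger than \<open>t\<close> the vector \<open>p s\<close> lies in \<open>S n\<close> and is no longer
  than \<open>p t\<close>, the shortest element of the intersection, so it is close to \<open>p t\<close>.\<close>

lemma p_right_continuous: "(p \<longlongrightarrow> p t) (at_right t)" if pos: "t > 0"
proof (rule tendstoI)
  fix e :: real assume "e > 0"
  define S where "S n = subdiff J 0 \<inter> {z. u t \<bullet> z \<ge> p t \<bullet> u t - 1 / real (Suc n)}" for n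
  obtain n where n: "\<And>z. z \<in> S n \<Longrightarrow> norm z \<le> norm (p t) \<Longrightarrow> norm (z - p t) < e"
  proof (rule nested_convex_near_min_norm[of S "p t" e])
    show "closed (S n)" "convex (S n)" for n
      unfolding S_def using closed_convex_subdiff_0[OF J]
      by (auto intro: closed_Int convex_Int closed_halfspace_ge convex_halfspace_ge)
    show "decseq S"
    proof (rule antimonoI)
      fix m n :: nat assume "m \<le> n"
      then have "1 / real (Suc n) \<le> 1 / real (Suc m)"
        by (intro divide_left_mono) auto
      then show "S n \<subseteq> S m" unfolding S_def by auto
    qed
    show "p t \<in> S n" for n
      using p_in_subdiff_0[OF pos] by (simp add: S_def inner_commute)
    fix z assume z: "\<And>n. z \<in> S n"
    have "p t \<bullet> u t \<le> z \<bullet> u t"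
    proof (rule LIMSEQ_le_const2)
      show "(\<lambda>n. p t \<bullet> u t - inverse (real (Suc n))) \<longlonglongrightarrow> p t \<bullet> u t"
        using tendsto_diff[OF tendsto_const LIMSEQ_inverse_real_of_nat] by simp
      show "\<exists>N. \<forall>n\<ge>N. p t \<bullet> u t - inverse (real (Suc n)) \<le> z \<bullet> u t"
        using z by (auto simp: S_def inner_commute inverse_eq_divide)
    qed
    then have "z \<bullet> u t = p t \<bullet> u t"
      using inner_u_le[OF pos, of z] z by (force simp: S_def)
    then have "z \<in> subdiff J (u t)"
      using z J_u[OF pos] mem_subdiff_iff[OF J, of z "u t"] by (auto simp: S_def)
    then show "norm (p t) \<le> norm z"
      using p_min_norm[OF pos] by blast
  qed (use \<open>e > 0\<close> in auto)
  have "((\<lambda>s. 2 * norm (p t) * norm (u s - u t)) \<longlongrightarrow> 2 * norm (p t) * norm (u t - u t)) (at_right t)"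
    using u_isCont[OF pos] by (intro tendsto_intros) (simp add: isCont_def filterlim_at_split)
  then have "\<forall>\<^sub>F s in at_right t. 2 * norm (p t) * norm (u s - u t) < 1 / real (Suc n)"
    by (intro order_tendstoD(2)) auto
  with eventually_at_right_less[of t] show "\<forall>\<^sub>F s in at_right t. dist (p s) (p t) < e"
  proof eventually_elim
    case (elim s)
    then have "s > 0" using pos by simp
    have norm_le: "norm (p s) \<le> norm (p t)"
      using norm_p_mono[OF pos, of s] elim by simp
    have "p t \<bullet> u s \<le> p s \<bullet> u s"
      by (rule inner_u_le[OF \<open>s > 0\<close> p_in_subdiff_0[OF pos]])
    then have "p s \<bullet> u t \<ge> p t \<bullet> u t - (p s - p t) \<bullet> (u s - u t)"
      by (simp add: inner_simps)
    moreover have "(p s - p t) \<bullet> (u s - u t) \<le> 2 * norm (p t) * norm (u s - u t)"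
    proof -
      have "norm (p s - p t) \<le> 2 * norm (p t)"
        using norm_triangle_ineq4[of "p s" "p t"] norm_le by simp
      then show ?thesis
        using norm_cauchy_schwarz[of "p s - p t" "u s - u t"]
          mult_right_mono[of "norm (p s - p t)" "2 * norm (p t)" "norm (u s - u t)"] by simp
    qed
    ultimately have "p s \<in> S n"
      using elim p_in_subdiff_0[OF \<open>s > 0\<close>] by (simp add: S_def inner_commute)
    then show ?case
      using n norm_le by (simp add: dist_norm)
  qed
qed

text \<open>The function is \<open>J \<circ> u\<close>. Subgradients bound its increments from both sides, and they are bounded on
  \<open>{s..}\<close>.\<close>

lemma J_u_continuous: "continuous_on {s..t} (\<lambda>\<sigma>. p \<sigma> \<bullet> u \<sigma>)" if "s > 0"
  unfolding continuous_on_def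
proof
  have one_sided: "p y \<bullet> u y - p x \<bullet> u x \<le> norm (p s) * norm (u y - u x)" if "s \<le> x" "s \<le> y" for x y
  proof -
    have "p y \<bullet> u x \<le> p x \<bullet> u x"
      using that \<open>s > 0\<close> by (intro inner_u_le p_in_subdiff_0) auto
    then have "p y \<bullet> u y - p x \<bullet> u x \<le> p y \<bullet> (u y - u x)"
      by (simp add: inner_simps)
    also have "\<dots> \<le> norm (p y) * norm (u y - u x)"
      by (rule norm_cauchy_schwarz)
    also have "\<dots> \<le> norm (p s) * norm (u y - u x)"
      using norm_p_mono[of s y] that \<open>s > 0\<close> by (intro mult_right_mono) auto
    finally show ?thesis .
  qed
  fix x assume x: "x \<in> {s..t}"
  have "(u \<longlongrightarrow> u x) (at x within {s..t})"
    using u_isCont[of x] x that by (auto intro: tendsto_within_subset simp: isCont_def)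
  then have "((\<lambda>y. norm (p s) * norm (u y - u x)) \<longlongrightarrow> norm (p s) * norm (u x - u x)) (at x within {s..t})"
    by (intro tendsto_intros)
  then have bound: "((\<lambda>y. norm (p s) * norm (u y - u x)) \<longlongrightarrow> 0) (at x within {s..t})"
    by simp
  have "((\<lambda>y. p y \<bullet> u y - p x \<bullet> u x) \<longlongrightarrow> 0) (at x within {s..t})"
  proof (rule Lim_null_comparison[OF _ bound])
    show "\<forall>\<^sub>F y in at x within {s..t}. norm (p y \<bullet> u y - p x \<bullet> u x) \<le> norm (p s) * norm (u y - u x)"
      unfolding eventually_at_filter
    proof (rule always_eventually, intro allI impI)
      fix y assume "y \<in> {s..t}"
      then show "norm (p y \<bullet> u y - p x \<bullet> u x) \<le> norm (p s) * norm (u y - u x)"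
        using one_sided[of x y] one_sided[of y x] x by (simp add: norm_minus_commute abs_le_iff)
    qed
  qed
  then show "((\<lambda>\<sigma>. p \<sigma> \<bullet> u \<sigma>) \<longlongrightarrow> p x \<bullet> u x) (at x within {s..t})"
    by (simp add: Lim_null[of _ "p x \<bullet> u x"])
qed

text \<open>The gap \<open>J (u \<sigma>) - p s \<bullet> u \<sigma>\<close> is nonnegative, starts at \<open>0\<close>, and does not increase because
  \<open>p s \<bullet> p \<sigma> \<le> (norm (p \<sigma>))\<^sup>2\<close>.\<close>

lemma p_in_later_subdiff:
  assumes "0 < s" "s \<le> t"
  shows "p s \<in> subdiff J (u t)"
proof -
  have "p t \<bullet> u t - p s \<bullet> u t \<le> p s \<bullet> u s - p s \<bullet> u s"
  proof (rule nonincreasing_by_right_slopes[OF \<open>s \<le> t\<close>])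
    show "continuous_on {s..t} (\<lambda>\<sigma>. p \<sigma> \<bullet> u \<sigma> - p s \<bullet> u \<sigma>)"
      using \<open>0 < s\<close> by (intro continuous_intros J_u_continuous continuous_on_subset[OF u_continuous]) auto
    show "p y \<bullet> u y - p s \<bullet> u y - (p \<sigma> \<bullet> u \<sigma> - p s \<bullet> u \<sigma>)
        \<le> (y - \<sigma>) * ((p y - p s) \<bullet> ((u y - u \<sigma>) /\<^sub>R (y - \<sigma>)))" if "s \<le> \<sigma>" "\<sigma> < y" for \<sigma> y
    proof -
      have "p y \<bullet> u \<sigma> \<le> p \<sigma> \<bullet> u \<sigma>"
        using that \<open>0 < s\<close> by (intro inner_u_le p_in_subdiff_0) auto
      moreover have "(y - \<sigma>) * ((p y - p s) \<bullet> ((u y - u \<sigma>) /\<^sub>R (y - \<sigma>))) = (p y - p s) \<bullet> (u y - u \<sigma>)"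
        using that by (intro inner_difference_quotient) simp
      ultimately show ?thesis
        by (simp only: inner_diff_left inner_diff_right)
    qed
    show "((\<lambda>y. (p y - p s) \<bullet> ((u y - u \<sigma>) /\<^sub>R (y - \<sigma>))) \<longlongrightarrow> (p \<sigma> - p s) \<bullet> (- p \<sigma>)) (at_right \<sigma>)"
      if "s \<le> \<sigma>" for \<sigma>
      using that \<open>0 < s\<close> by (intro tendsto_intros u_slope p_right_continuous) auto
    show "(p \<sigma> - p s) \<bullet> (- p \<sigma>) \<le> 0" if "s \<le> \<sigma>" for \<sigma>
      using inner_p_le[of \<sigma> "p s"] p_in_subdiff_0 that \<open>0 < s\<close>
      by (simp add: inner_simps power2_norm_eq_inner)
  qed
  then have "p s \<bullet> u t = p t \<bullet> u t"
    using inner_u_le[of t "p s"] p_in_subdiff_0[of s] assms by simp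
  then show ?thesis
    using assms p_in_subdiff_0[of s] J_u[of t] mem_subdiff_iff[OF J, of "p s" "u t"] by simp
qed

text \<open>This vector is the mean value of \<open>p\<close> over \<open>(s, t)\<close>, and all values of \<open>p\<close> there belong to the
  convex set \<open>subdiff J (u t)\<close>.\<close>

lemma average_in_subdiff:
  assumes "0 < s" "s < t"
  shows "(u s - u t) /\<^sub>R (t - s) \<in> subdiff J (u t)"
proof -
  have dual: "ereal (((u s - u t) /\<^sub>R (t - s)) \<bullet> x) \<le> J x" for x
  proof (cases "J x")
    case (real c)
    have "(u s - u t) \<bullet> x \<le> c * (t - s)"
    proof (rule inner_decrease_le)
      fix \<sigma> assume "s \<le> \<sigma>"
      then have "ereal (p \<sigma> \<bullet> x) \<le> J x"
        using p_in_subdiff_0[of \<sigma>] assms mem_subdiff_0_iff[OF J, of "p \<sigma>"] by simp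
      then show "p \<sigma> \<bullet> x \<le> c"
        using real by simp
    qed (use assms in auto)
    then show ?thesis
      using real assms by (simp add: inverse_eq_divide pos_divide_le_eq)
  next
    case MInf
    then show ?thesis using J by (simp add: class_C_def)
  qed simp
  have "(u s - u t) \<bullet> (- u t) \<le> - (p t \<bullet> u t) * (t - s)"
  proof (rule inner_decrease_le)
    fix \<sigma> assume "s \<le> \<sigma>" "\<sigma> < t"
    then have "ereal (p \<sigma> \<bullet> u t) = J (u t)"
      using p_in_later_subdiff[of \<sigma> t] assms by (simp add: subdiff_def)
    then show "p \<sigma> \<bullet> (- u t) \<le> - (p t \<bullet> u t)"
      using J_u[of t] assms by simp
  qed (use assms in auto)
  then have "p t \<bullet> u t \<le> ((u s - u t) /\<^sub>R (t - s)) \<bullet> u t"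
    using assms by (simp add: inverse_eq_divide pos_le_divide_eq)
  moreover have "((u s - u t) /\<^sub>R (t - s)) \<bullet> u t \<le> p t \<bullet> u t"
    using dual[of "u t"] J_u[of t] assms by simp
  ultimately show ?thesis
    using dual J_u[of t] assms by (auto simp: subdiff_def)
qed

lemma total_average_in_subdiff:
  assumes "t > 0"
  shows "(f - u t) /\<^sub>R t \<in> subdiff J (u t)"
proof (rule Lim_in_closed_set[OF closed_convex_subdiff(1)[OF J]])
  have "(u \<longlongrightarrow> u 0) (at 0 within {0..})"
    using u_continuous by (simp add: continuous_on_def)
  then have "(u \<longlongrightarrow> f) (at_right 0)"
    unfolding u_0 by (rule tendsto_within_subset) auto
  then have "((\<lambda>s. (u s - u t) /\<^sub>R (t - s)) \<longlongrightarrow> (f - u t) /\<^sub>R (t - 0)) (at_right 0)"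
    using assms by (intro tendsto_intros) auto
  then show "((\<lambda>s. (u s - u t) /\<^sub>R (t - s)) \<longlongrightarrow> (f - u t) /\<^sub>R t) (at_right 0)"
    by simp
  show "\<forall>\<^sub>F s in at_right 0. (u s - u t) /\<^sub>R (t - s) \<in> subdiff J (u t)"
    unfolding eventually_at_right_field using average_in_subdiff[of _ t] assms by blast
qed simp

text \<open>Write \<open>q\<close> for the subgradient. Then \<open>q \<bullet> p t = (norm (p t))\<^sup>2 = J (p t)\<close>, so
  \<open>q \<bullet> (u t + t p t) = J (u t) + J (t p t)\<close>, and this is at least \<open>J (u t + t p t)\<close> by
  subadditivity.\<close>

lemma total_average_in_subdiff_extrapolation:
  assumes "t > 0"
  shows "(f - u t) /\<^sub>R t \<in> subdiff J (u t + t *\<^sub>R p t)"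
proof -
  define q where "q = (f - u t) /\<^sub>R t"
  have q: "q \<in> subdiff J (u t)"
    unfolding q_def by (rule total_average_in_subdiff[OF assms])
  then have q0: "q \<in> subdiff J 0"
    using mem_subdiff_iff[OF J] by blast
  have q_p: "q \<bullet> p t = (norm (p t))\<^sup>2"
    using inner_p_le[OF assms q0] inner_p_ge[OF assms q] by simp
  have "J (p t) = ereal (p t \<bullet> p t)"
    using eigenvector[OF assms] by (simp add: subdiff_def)
  then have J_tp: "J (t *\<^sub>R p t) = ereal (t * (norm (p t))\<^sup>2)"
    using class_C_scale[OF J, of t "p t"] assms by (simp add: power2_norm_eq_inner)
  have J_u': "J (u t) = ereal (q \<bullet> u t)"
    using q by (simp add: subdiff_def)
  have "J (u t + t *\<^sub>R p t) \<le> ereal (q \<bullet> (u t + t *\<^sub>R p t))"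
    using class_C_add_le[OF J, of "u t" "t *\<^sub>R p t"] q_p by (simp add: J_tp J_u' inner_simps)
  moreover have "ereal (q \<bullet> (u t + t *\<^sub>R p t)) \<le> J (u t + t *\<^sub>R p t)"
    using q0 mem_subdiff_0_iff[OF J] by blast
  ultimately have "ereal (q \<bullet> (u t + t *\<^sub>R p t)) = J (u t + t *\<^sub>R p t)"
    by (rule order_antisym[rotated])
  then have "q \<in> subdiff J (u t + t *\<^sub>R p t)"
    using q0 mem_subdiff_iff[OF J] by blast
  then show ?thesis by (simp add: q_def)
qed

text \<open>The vector \<open>(f - u t) / t\<close> is a subgradient at \<open>u t\<close>, which is the optimality condition; by strong
  convexity every other point exceeds the energy of \<open>u t\<close> by at least half its squared distance
  from \<open>u t\<close>.\<close>

lemma variational_minimizer_eq: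
  assumes "t > 0" and v: "is_arg_min (variational_energy J f t) (\<lambda>_. True) v"
  shows "v = u t"
proof -
  define q where "q = (f - u t) /\<^sub>R t"
  have q: "q \<in> subdiff J (u t)"
    unfolding q_def by (rule total_average_in_subdiff[OF assms(1)])
  have tq: "t *\<^sub>R q = f - u t"
    using assms by (simp add: q_def)
  have J_u': "J (u t) = ereal (q \<bullet> u t)"
    using q by (simp add: subdiff_def)
  have q_v: "ereal (q \<bullet> v) \<le> J v"
    using q by (simp add: subdiff_def)
  have le: "variational_energy J f t v \<le> variational_energy J f t (u t)"
    using v by (simp add: is_arg_min_def not_less)
  have "J v \<noteq> \<infinity>"
    using le assms by (auto simp: variational_energy_def J_u')
  then obtain c where c: "J v = ereal c"
    using q_v by (cases "J v") auto
  have "(norm (v - f))\<^sup>2 / 2 + t * c \<le> (norm (u t - f))\<^sup>2 / 2 + t * (q \<bullet> u t)"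
    using le by (simp add: variational_energy_def J_u' c)
  moreover have "t * (q \<bullet> v) \<le> t * c"
    using q_v c assms by (intro mult_left_mono) auto
  ultimately have "(norm (v - f))\<^sup>2 / 2 + (f - u t) \<bullet> v \<le> (norm (u t - f))\<^sup>2 / 2 + (f - u t) \<bullet> u t"
    by (simp flip: tq)
  then have "(norm (v - u t))\<^sup>2 \<le> 0"
    unfolding power2_norm_eq_inner by (simp add: inner_simps inner_commute field_simps)
  then show ?thesis by simp
qed

text \<open>Write \<open>m\<close> for the mean value. It is no longer than \<open>p s\<close>, and \<open>m \<bullet> p t \<ge> (norm (p t))\<^sup>2\<close> since it
  lies in \<open>subdiff J (u t)\<close>; expand the square.\<close>

lemma average_near_p:
  assumes "0 < s" "s < t"
  shows "(norm ((u s - u t) /\<^sub>R (t - s) - p t))\<^sup>2 \<le> (norm (p s))\<^sup>2 - (norm (p t))\<^sup>2"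
proof -
  define m where "m = (u s - u t) /\<^sub>R (t - s)"
  have "(norm (p t))\<^sup>2 \<le> m \<bullet> p t"
    unfolding m_def using assms by (intro inner_p_ge average_in_subdiff) auto
  moreover have "(norm m)\<^sup>2 \<le> (norm (p s))\<^sup>2"
  proof -
    have "(u s - u t) \<bullet> m \<le> (norm (p s) * norm m) * (t - s)"
    proof (rule inner_decrease_le)
      fix \<sigma> assume "s \<le> \<sigma>"
      then have "norm (p \<sigma>) * norm m \<le> norm (p s) * norm m"
        using norm_p_mono[of s \<sigma>] assms by (intro mult_right_mono) auto
      then show "p \<sigma> \<bullet> m \<le> norm (p s) * norm m"
        using norm_cauchy_schwarz[of "p \<sigma>" m] by simp
    qed (use assms in auto)
    moreover have "u s - u t = (t - s) *\<^sub>R m"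
      using assms by (simp add: m_def)
    ultimately have "(t - s) * (norm m * norm m) \<le> (t - s) * (norm (p s) * norm m)"
      by (simp add: power2_norm_eq_inner mult.commute flip: power2_eq_square)
    then have "norm m \<le> norm (p s)"
      using assms by (cases "m = 0") auto
    then show ?thesis by (intro power_mono) auto
  qed
  moreover have "(norm (m - p t))\<^sup>2 = (norm m)\<^sup>2 - 2 * (m \<bullet> p t) + (norm (p t))\<^sup>2"
    by (simp add: power2_norm_eq_inner inner_simps inner_commute)
  ultimately show ?thesis unfolding m_def by linarith
qed

text \<open>The right derivative is part of the definition of the flow; for the left one the difference
  quotients are mean values of \<open>p\<close>, controlled by the preceding lemma.\<close>

lemma u_has_vector_derivative:
  assumes "t > 0" and cont: "isCont (\<lambda>s. (norm (p s))\<^sup>2) t"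
  shows "(u has_vector_derivative - p t) (at t)"
proof -
  have "((\<lambda>s. (norm (p s))\<^sup>2) \<longlongrightarrow> (norm (p t))\<^sup>2) (at_left t)"
    using cont by (simp add: isCont_def filterlim_at_split)
  then have "((\<lambda>s. sqrt ((norm (p s))\<^sup>2 - (norm (p t))\<^sup>2)) \<longlongrightarrow> sqrt ((norm (p t))\<^sup>2 - (norm (p t))\<^sup>2)) (at_left t)"
    by (intro tendsto_real_sqrt tendsto_diff tendsto_const)
  then have bound: "((\<lambda>s. sqrt ((norm (p s))\<^sup>2 - (norm (p t))\<^sup>2)) \<longlongrightarrow> 0) (at_left t)"
    by simp
  have "\<forall>\<^sub>F s in at_left t. 0 < s \<and> s < t"
    using \<open>t > 0\<close> eventually_at_left_field[of "\<lambda>s. 0 < s \<and> s < t" t] by blast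
  then have "\<forall>\<^sub>F s in at_left t. norm ((u s - u t) /\<^sub>R (s - t) - - p t) \<le> sqrt ((norm (p s))\<^sup>2 - (norm (p t))\<^sup>2)"
  proof eventually_elim
    case (elim s)
    have "(u s - u t) /\<^sub>R (s - t) - - p t = - ((u s - u t) /\<^sub>R (t - s) - p t)"
    proof -
      have "inverse (s - t) = - inverse (t - s)"
        by (metis inverse_minus_eq minus_diff_eq)
      then show ?thesis by (simp add: scaleR_minus_left)
    qed
    then show ?case
      using average_near_p[of s t] elim by (simp add: real_le_rsqrt norm_minus_commute)
  qed
  then have "((\<lambda>s. (u s - u t) /\<^sub>R (s - t) - - p t) \<longlongrightarrow> 0) (at_left t)"
    by (rule Lim_null_comparison) (rule bound)
  then have "((\<lambda>s. (u s - u t) /\<^sub>R (s - t)) \<longlongrightarrow> - p t) (at_left t)"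
    by (rule Lim_null[THEN iffD2])
  with u_slope[OF \<open>t > 0\<close>] show ?thesis
    by (simp add: has_vector_derivative_iff_quotient filterlim_at_split)
qed

lemma countable_discontinuities: "countable {t\<in>{0<..}. \<not> isCont (\<lambda>s. (norm (p s))\<^sup>2) t}"
proof -
  have "mono_on {0<..} (\<lambda>s. - (norm (p s))\<^sup>2)"
    using norm_p_mono by (auto intro!: mono_onI power_mono)
  then have "countable {t\<in>{0<..}. \<not> isCont (\<lambda>s. - (norm (p s))\<^sup>2) t}"
    by (rule mono_on_ctble_discont_open[OF open_greaterThan])
  moreover have "isCont (\<lambda>s. - (norm (p s))\<^sup>2) t \<longleftrightarrow> isCont (\<lambda>s. (norm (p s))\<^sup>2) t" for t
    using continuous_minus[of "at t" "\<lambda>s. - (norm (p s))\<^sup>2"] continuous_minus[of "at t" "\<lambda>s. (norm (p s))\<^sup>2"]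
    by auto
  ultimately show ?thesis by simp
qed

text \<open>The mean value of \<open>p\<close> over \<open>(s, t)\<close> is a subgradient at \<open>u t\<close>, so \<open>(u s - u t) \<bullet> u t\<close> is
  \<open>(t - s) J (u t)\<close>, which is nonnegative.\<close>

lemma norm_diff_square_le:
  assumes "0 < s" "s \<le> t"
  shows "(norm (u s - u t))\<^sup>2 \<le> (norm (u s))\<^sup>2 - (norm (u t))\<^sup>2"
proof (cases "s = t")
  case False
  then have "ereal (((u s - u t) /\<^sub>R (t - s)) \<bullet> u t) = J (u t)"
    using average_in_subdiff[of s t] assms by (simp add: subdiff_def)
  then have "0 \<le> ((u s - u t) /\<^sub>R (t - s)) \<bullet> u t"
    using class_C_nonneg[OF J, of "u t"] by (simp flip: \<open>ereal _ = J (u t)\<close>)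
  then have "0 \<le> (u s - u t) \<bullet> u t"
    using False assms by (simp add: zero_le_mult_iff)
  then show ?thesis
    by (simp add: power2_norm_eq_inner inner_simps inner_commute)
qed simp

text \<open>By the previous lemma \<open>(norm (u t))\<^sup>2\<close> is nonincreasing, hence convergent, and this makes \<open>u\<close>
  Cauchy at infinity.\<close>

lemma u_converges: "\<exists>L. (u \<longlongrightarrow> L) at_top"
proof -
  define low where "low = (INF t\<in>{1..}. (norm (u t))\<^sup>2)"
  have bdd: "bdd_below ((\<lambda>t. (norm (u t))\<^sup>2) ` {1..})"
    by (rule bdd_belowI2[where m = 0]) simp
  have attained: "\<exists>s\<in>{1..}. (norm (u s))\<^sup>2 < c" if "low < c" for c
    using that bdd unfolding low_def by (subst (asm) cINF_less_iff) auto
  have near: "\<exists>s\<ge>1. \<forall>t\<ge>s. norm (u s - u t) < e" if "e > 0" for e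
  proof -
    have "low < low + e\<^sup>2" using that by simp
    then obtain s where s: "s \<ge> 1" "(norm (u s))\<^sup>2 < low + e\<^sup>2"
      using attained[OF \<open>low < low + e\<^sup>2\<close>] by auto
    have "norm (u s - u t) < e" if "t \<ge> s" for t
    proof -
      have "low \<le> (norm (u t))\<^sup>2"
        unfolding low_def using that s by (intro cINF_lower bdd) auto
      then have "(norm (u s - u t))\<^sup>2 < e\<^sup>2"
        using norm_diff_square_le[of s t] that s by simp
      then show ?thesis using \<open>e > 0\<close> by (simp add: power2_less_imp_less)
    qed
    with s show ?thesis by blast
  qed
  have near2: "\<exists>s\<ge>1. \<forall>x\<ge>s. \<forall>y\<ge>s. dist (u x) (u y) < e" if "e > 0" for e
  proof -
    obtain s where s: "s \<ge> 1" "\<And>t. t \<ge> s \<Longrightarrow> norm (u s - u t) < e / 2"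
      using near[OF half_gt_zero[OF \<open>e > 0\<close>]] by blast
    have "dist (u x) (u y) < e" if "x \<ge> s" "y \<ge> s" for x y
      by (rule dist_triangle_half_r[of "u s"]) (use s that in \<open>auto simp: dist_norm\<close>)
    with s(1) show ?thesis by blast
  qed
  have "Cauchy (\<lambda>n. u (real n))"
  proof (rule metric_CauchyI)
    fix e :: real assume "e > 0"
    then obtain s where s: "\<And>x y. x \<ge> s \<Longrightarrow> y \<ge> s \<Longrightarrow> dist (u x) (u y) < e"
      using near2 by blast
    obtain N where "s \<le> real N" using real_arch_simple by blast
    then show "\<exists>M. \<forall>m\<ge>M. \<forall>n\<ge>M. dist (u (real m)) (u (real n)) < e"
      by (intro exI[of _ N] allI impI s) auto
  qed
  then obtain L where L: "(\<lambda>n. u (real n)) \<longlonglongrightarrow> L"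
    using Cauchy_convergent_iff convergent_def by blast
  have "(u \<longlongrightarrow> L) at_top"
  proof (rule tendstoI)
    fix e :: real assume "e > 0"
    then obtain s where s: "\<And>x y. x \<ge> s \<Longrightarrow> y \<ge> s \<Longrightarrow> dist (u x) (u y) < e / 2"
      using near2[OF half_gt_zero[OF \<open>e > 0\<close>]] by blast
    have "dist (u x) L < e" if "x \<ge> s" for x
    proof -
      have "(\<lambda>n. dist (u x) (u (real n))) \<longlonglongrightarrow> dist (u x) L"
        by (intro tendsto_intros L)
      moreover obtain N where "s \<le> real N" using real_arch_simple by blast
      then have "\<exists>N. \<forall>n\<ge>N. dist (u x) (u (real n)) \<le> e / 2"
        using that by (intro exI[of _ N] allI impI less_imp_le[OF s]) auto
      ultimately have "dist (u x) L \<le> e / 2"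
        by (rule LIMSEQ_le_const2)
      then show ?thesis using \<open>e > 0\<close> by simp
    qed
    then show "\<forall>\<^sub>F x in at_top. dist (u x) L < e"
      by (auto simp: eventually_at_top_linorder)
  qed
  then show ?thesis by blast
qed

text \<open>As \<open>p t\<close> has minimal norm in \<open>subdiff J (u t)\<close>, it is no longer than the mean value of \<open>p\<close> over
  \<open>(t / 2, t)\<close>.\<close>

lemma time_times_p_vanishes: "((\<lambda>t. t *\<^sub>R p t) \<longlongrightarrow> 0) at_top"
proof -
  obtain L where L: "(u \<longlongrightarrow> L) at_top"
    using u_converges by blast
  have half: "filterlim (\<lambda>t::real. t / 2) at_top at_top"
    using filterlim_tendsto_pos_mult_at_top[OF tendsto_const[of "1/2"] _ filterlim_ident] by simp
  have "((\<lambda>t. 2 * norm (u (t / 2) - u t)) \<longlongrightarrow> 2 * norm (L - L)) at_top"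
    by (intro tendsto_intros L filterlim_compose[OF L half])
  then have lim: "((\<lambda>t. 2 * norm (u (t / 2) - u t)) \<longlongrightarrow> 0) at_top"
    by simp
  have "\<forall>\<^sub>F t in at_top. norm (t *\<^sub>R p t) \<le> 2 * norm (u (t / 2) - u t)"
    using eventually_gt_at_top[of 0]
  proof eventually_elim
    case (elim t)
    have "norm (p t) \<le> norm ((u (t / 2) - u t) /\<^sub>R (t - t / 2))"
      using elim by (intro p_min_norm average_in_subdiff) auto
    also have "(u (t / 2) - u t) /\<^sub>R (t - t / 2) = (2 / t) *\<^sub>R (u (t / 2) - u t)"
      by (simp add: inverse_eq_divide)
    finally have "norm (p t) \<le> (2 / t) * norm (u (t / 2) - u t)"
      using elim by simp
    then show ?case
      using elim by (simp add: field_simps)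
  qed
  then show ?thesis
    by (rule Lim_null_comparison) (rule lim)
qed

lemma p_vanishes: "(p \<longlongrightarrow> 0) at_top"
proof -
  have "((\<lambda>t. inverse t *\<^sub>R (t *\<^sub>R p t)) \<longlongrightarrow> 0 *\<^sub>R 0) at_top"
    by (intro tendsto_scaleR time_times_p_vanishes tendsto_inverse_0_at_top filterlim_ident)
  then show ?thesis
    by (rule Lim_transform_eventually[THEN tendsto_eq_rhs])
       (auto intro!: eventually_mono[OF eventually_gt_at_top[of 0]])
qed

text \<open>The limit \<open>L\<close> is a zero of \<open>J\<close> since \<open>J (u t) = p t \<bullet> u t \<rightarrow> 0\<close>. Subgradients are orthogonal to
  each zero \<open>z\<close> of \<open>J\<close>, because \<open>J z = J (- z) = 0\<close>; so are \<open>f - u t = t q t\<close> and its limit \<open>f - L\<close>.\<close>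

lemma u_tendsto_orth_proj: "(u \<longlongrightarrow> orth_proj (nullspace J) f) at_top"
proof -
  obtain L where L: "(u \<longlongrightarrow> L) at_top"
    using u_converges by blast
  have "J L \<le> ereal (0 \<bullet> L)"
  proof (rule class_C_le_of_tendsto[OF J L])
    show "((\<lambda>t. p t \<bullet> u t) \<longlongrightarrow> 0 \<bullet> L) at_top"
      by (intro tendsto_intros L p_vanishes)
    show "\<forall>\<^sub>F t in at_top. J (u t) \<le> ereal (p t \<bullet> u t)"
      using eventually_gt_at_top[of 0] by eventually_elim (simp add: J_u)
  qed simp
  then have "J L = 0"
    using class_C_nonneg[OF J, of L] by (simp add: zero_ereal_def order_antisym)
  have ortho: "(f - L) \<bullet> z = 0" if "z \<in> nullspace J" for z
  proof -
    have Jz: "J z = 0" using that by (simp add: nullspace_def)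
    have Jmz: "J (- z) = 0" using class_C_minus[OF J, of z] by (simp add: Jz)
    have zero: "(f - u t) \<bullet> z = 0" if "t > 0" for t
    proof -
      have "ereal (((f - u t) /\<^sub>R t) \<bullet> x) \<le> J x" for x
        using total_average_in_subdiff[OF that] by (simp add: subdiff_def)
      from this[of z] this[of "- z"] have "((f - u t) /\<^sub>R t) \<bullet> z = 0"
        by (simp add: Jz Jmz zero_ereal_def)
      then show ?thesis using that by simp
    qed
    have "((\<lambda>t. (f - u t) \<bullet> z) \<longlongrightarrow> (f - L) \<bullet> z) at_top"
      by (intro tendsto_intros L)
    moreover have "((\<lambda>t. (f - u t) \<bullet> z) \<longlongrightarrow> 0) at_top"
      by (intro tendsto_eventually eventually_mono[OF eventually_gt_at_top[of 0]] zero)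
    ultimately show ?thesis
      using tendsto_unique trivial_limit_at_top_linorder by blast
  qed
  have "orth_proj (nullspace J) f = L"
    using \<open>J L = 0\<close> ortho by (intro orth_proj_eqI) (auto simp: nullspace_def)
  then show ?thesis using L by simp
qed

text \<open>The chain rule applied to \<open>r \<tau> = \<tau> (f - u (1 / \<tau>))\<close> gives \<open>f - w \<tau>\<close> at all \<open>\<tau>\<close> for which \<open>u\<close> is
  differentiable at \<open>1 / \<tau>\<close>; the remaining \<open>\<tau>\<close> form a countable set.\<close>

lemma inverse_scale_space:
  assumes w: "\<And>\<tau>. \<tau> > 0 \<Longrightarrow> w \<tau> = u (1 / \<tau>) + (1 / \<tau>) *\<^sub>R p (1 / \<tau>)"
    and r: "\<And>\<tau>. \<tau> > 0 \<Longrightarrow> r \<tau> = \<tau> *\<^sub>R (f - u (1 / \<tau>))"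
  shows "inverse_scale_space_flow J f w r"
proof -
  define D where "D = (\<lambda>t. 1 / t) ` {t\<in>{0<..}. \<not> isCont (\<lambda>s. (norm (p s))\<^sup>2) t}"
  have D: "countable D"
    unfolding D_def by (intro countable_image countable_discontinuities)
  have r_der: "(r has_vector_derivative f - w \<tau>) (at \<tau>)" if "\<tau> > 0" "\<tau> \<notin> D" for \<tau>
  proof -
    have "isCont (\<lambda>s. (norm (p s))\<^sup>2) (1 / \<tau>)"
    proof (rule ccontr)
      assume "\<not> ?thesis"
      then have "1 / (1 / \<tau>) \<in> D"
        unfolding D_def using that by (intro imageI) auto
      then show False using that by simp
    qed
    then have u_der: "(u has_vector_derivative - p (1 / \<tau>)) (at (1 / \<tau>))"
      using that by (intro u_has_vector_derivative) auto
    have "((\<lambda>y. 1 / y) has_real_derivative - 1 / \<tau>\<^sup>2) (at \<tau>)"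
      using that by (auto intro!: derivative_eq_intros simp: power2_eq_square)
    then have "((\<lambda>y. 1 / y) has_vector_derivative - 1 / \<tau>\<^sup>2) (at \<tau>)"
      by (simp add: has_real_derivative_iff_has_vector_derivative)
    from vector_diff_chain_at[OF this u_der]
    have "((\<lambda>y. f - u (1 / y)) has_vector_derivative 0 - (- 1 / \<tau>\<^sup>2) *\<^sub>R - p (1 / \<tau>)) (at \<tau>)"
      by (intro has_vector_derivative_diff has_vector_derivative_const) (simp add: o_def)
    from has_vector_derivative_scaleR[OF DERIV_ident this]
    have "((\<lambda>y. y *\<^sub>R (f - u (1 / y))) has_vector_derivative f - w \<tau>) (at \<tau>)"
      using that by (simp add: w power2_eq_square algebra_simps)
    then show ?thesis
    proof (rule has_vector_derivative_transform_within_open)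
      show "open {0::real<..}" by (rule open_greaterThan)
    qed (use that r in auto)
  qed
  have "continuous_on {0<..} (\<lambda>\<tau>. \<tau> *\<^sub>R (f - u (1 / \<tau>)))"
    by (intro continuous_intros continuous_on_compose2[OF u_continuous, of _ "\<lambda>\<tau>. 1 / \<tau>"]) auto
  then have r_cont: "continuous_on {0<..} r"
    by (rule continuous_on_eq) (simp add: r)
  have bdd: "bounded ((\<lambda>\<tau>. f - w \<tau>) ` {a..b})" if "0 < a" "a \<le> b" for a b
  proof -
    have "continuous_on {1 / b..1 / a} u"
      by (rule continuous_on_subset[OF u_continuous]) (use that in auto)
    then have "bounded (u ` {1 / b..1 / a})"
      by (intro compact_imp_bounded compact_continuous_image) auto
    then obtain B where B: "\<And>t. t \<in> {1 / b..1 / a} \<Longrightarrow> norm (u t) \<le> B"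
      unfolding bounded_iff by blast
    have "norm (f - w \<tau>) \<le> norm f + (B + 1 / a * norm (p (1 / b)))" if \<tau>: "\<tau> \<in> {a..b}" for \<tau>
    proof -
      have inv: "1 / b \<le> 1 / \<tau>" "1 / \<tau> \<le> 1 / a" "0 < 1 / b" "0 < 1 / \<tau>"
        using \<tau> \<open>0 < a\<close> \<open>a \<le> b\<close> by (auto simp: field_simps)
      have "norm ((1 / \<tau>) *\<^sub>R p (1 / \<tau>)) = 1 / \<tau> * norm (p (1 / \<tau>))"
        using inv by simp
      also have "\<dots> \<le> 1 / a * norm (p (1 / b))"
        using inv \<open>0 < a\<close> by (intro mult_mono norm_p_mono) auto
      finally have "norm (w \<tau>) \<le> B + 1 / a * norm (p (1 / b))"
        using w[of \<tau>] B[of "1 / \<tau>"] inv norm_triangle_ineq[of "u (1 / \<tau>)" "(1 / \<tau>) *\<^sub>R p (1 / \<tau>)"]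
        by (simp add: zero_less_divide_iff)
      then show ?thesis
        using norm_triangle_ineq4[of f "w \<tau>"] by linarith
    qed
    then show ?thesis unfolding bounded_iff by blast
  qed
  have inv_at_top: "filterlim (\<lambda>\<tau>::real. 1 / \<tau>) at_top (at_right 0)"
    using filterlim_inverse_at_top_right by (simp add: inverse_eq_divide)
  note u_lim = filterlim_compose[OF u_tendsto_orth_proj inv_at_top]
  show ?thesis
    unfolding inverse_scale_space_flow_def
  proof (intro conjI allI impI)
    show "has_weak_derivative_pos r (\<lambda>\<tau>. f - w \<tau>)"
      by (rule has_weak_derivative_posI[OF r_cont D r_der bdd])
    have "AE \<tau> in lborel. \<tau> \<notin> D"
      by (intro AE_not_in countable_imp_null_set_lborel D)
    then show "AE \<tau> in lborel. 0 < \<tau> \<longrightarrow> (r has_vector_derivative f - w \<tau>) (at \<tau>)"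
      using r_der by (auto elim: eventually_mono)
    show "r \<tau> \<in> subdiff J (w \<tau>)" if "\<tau> > 0" for \<tau>
      using total_average_in_subdiff_extrapolation[of "1 / \<tau>"] that by (simp add: r w)
    have "((\<lambda>\<tau>. \<tau> *\<^sub>R (f - u (1 / \<tau>))) \<longlongrightarrow> 0 *\<^sub>R (f - orth_proj (nullspace J) f)) (at_right 0)"
      by (intro tendsto_intros u_lim)
    then show "(r \<longlongrightarrow> 0) (at_right 0)"
      by (rule Lim_transform_eventually[THEN tendsto_eq_rhs])
         (auto intro!: eventually_mono[OF eventually_at_right_less] simp: r)
    have "((\<lambda>\<tau>. u (1 / \<tau>) + (1 / \<tau>) *\<^sub>R p (1 / \<tau>)) \<longlongrightarrow> orth_proj (nullspace J) f + 0) (at_right 0)"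
      by (intro tendsto_add u_lim filterlim_compose[OF time_times_p_vanishes inv_at_top])
    then show "(w \<longlongrightarrow> orth_proj (nullspace J) f) (at_right 0)"
      by (rule Lim_transform_eventually[THEN tendsto_eq_rhs])
         (auto intro!: eventually_mono[OF eventually_at_right_less] simp: w)
  qed
qed

end

section \<open>The inverse scale space flow\<close>

theorem theorem4p6:
  fixes J :: "'a::{real_inner,complete_space} \<Rightarrow> ereal"
    and f :: 'a
    and u p v q w r :: "real \<Rightarrow> 'a"
  assumes J: "class_C J"
    and f: "f \<in> closure (dom_subdiff J)"
    and flow: "gradient_flow J f u p"
    and eigenvectors: "\<And>t. t > 0 \<Longrightarrow> p t \<in> subdiff J (p t)"
    and v: "\<And>t. t > 0 \<Longrightarrow> is_arg_min (variational_energy J f t) (\<lambda>_. True) (v t)"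
    and q: "\<And>t. t > 0 \<Longrightarrow> q t = (f - v t) /\<^sub>R t"
    and w: "\<And>\<tau>. \<tau> > 0 \<Longrightarrow>
        w \<tau> = v (1 / \<tau>) - (1 / \<tau>) *\<^sub>R vector_derivative v (at_right (1 / \<tau>))"
    and r: "\<And>\<tau>. \<tau> > 0 \<Longrightarrow> r \<tau> = q (1 / \<tau>)"
  shows "(\<forall>t>0. q t \<in> subdiff J (v t)) \<and>
         (\<forall>t>0. v differentiable (at_right t)) \<and>
         inverse_scale_space_flow J f w r"
proof -
  interpret eigenvector_flow J f u p
    using J flow eigenvectors by unfold_locales
  have v_eq: "v t = u t" if "t > 0" for t
    by (rule variational_minimizer_eq[OF that v[OF that]])
  have v_der: "(v has_vector_derivative - p t) (at_right t)" if "t > 0" for t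
    unfolding has_vector_derivative_iff_quotient
  proof (rule Lim_transform_eventually[OF u_slope[OF that]])
    show "\<forall>\<^sub>F s in at_right t. (u s - u t) /\<^sub>R (s - t) = (v s - v t) /\<^sub>R (s - t)"
      using eventually_at_right_less[of t] by eventually_elim (use that v_eq in auto)
  qed
  have "vector_derivative v (at_right t) = - p t" if "t > 0" for t
    using v_der[OF that] by (intro vector_derivative_within) auto
  then have "inverse_scale_space_flow J f w r"
    by (intro inverse_scale_space) (auto simp: w r q v_eq)
  moreover have "q t \<in> subdiff J (v t)" if "t > 0" for t
    using total_average_in_subdiff[OF that] that by (simp add: q v_eq)
  moreover have "v differentiable (at_right t)" if "t > 0" for t
    using v_der[OF that] by (rule differentiableI_vector)
  ultimately show ?thesis by blast
qed

end
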